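(* There exist infinitely many positive integers $n$ such that \[ \operatorname{Cond}(V_n) > \exp\!\big(n^{\log 2/\log\log n}\big)/\sqrt{n}. \] In particular, for every fixed $r>0$, it is not the case that $\operatorname{Cond}(V_n) = O(n^r)$ as $n\to\infty$.
   Context: For a positive integer $n$, let $m=\varphi(n)$ (Euler's totient), and let $\zeta_{n,0},\dots,\zeta_{n,m-1}$ be the primitive $n$th roots of unity in $\mathbb{C}$ (in any fixed order). $V_n$ is the $m\times m$ Vandermonde matrix whose $(i,j)$ entry is $\zeta_{n,i}^{\,j}$ for $0\le i,j\le m-1$. For a complex square matrix $V$, $\|V\|:=\sqrt{\operatorname{Tr}(V^*V)}$ is the Frobenius norm ($V^*$ the conjugate transpose), and the condition number is $\operatorname{Cond}(V):=\|V\|\,\|V^{-1}\|$. Here $\log$ denotes the natural logarithm. *)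

theory Defs
  imports
    Complex_Main
    "HOL-Library.Landau_Symbols"
    "HOL-Number_Theory.Totient"
    "Jordan_Normal_Form.Gauss_Jordan_Elimination"
    "Jordan_Normal_Form.Schur_Decomposition"
begin

definition primitive_unity_roots :: "nat \<Rightarrow> complex set" where
  "primitive_unity_roots n = {z. z ^ n = 1 \<and> (\<forall>k. 0 < k \<and> k < n \<longrightarrow> z ^ k \<noteq> 1)}"

(* z is an enumeration of the primitive n-th roots of unity; only its values on {..<totient n}
   matter. *)
definition unity_vandermonde :: "nat \<Rightarrow> (nat \<Rightarrow> complex) \<Rightarrow> complex mat" where
  "unity_vandermonde n z = mat (totient n) (totient n) (\<lambda>(i, j). z i ^ j)"

definition mat_trace :: "'a :: comm_monoid_add mat \<Rightarrow> 'a" where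
  "mat_trace A = (\<Sum>i<dim_row A. A $$ (i, i))"

(* The trace is a nonnegative real here, so taking the real part loses nothing. *)
definition frobenius_norm :: "complex mat \<Rightarrow> real" where
  "frobenius_norm V = sqrt (Re (mat_trace (mat_adjoint V * V)))"

(* mat_inverse returns Some of the two-sided inverse exactly when V is square and invertible;
   the value for other V is unspecified. *)
definition condition_number :: "complex mat \<Rightarrow> real" where
  "condition_number V = frobenius_norm V * frobenius_norm (the (mat_inverse V))"

end

(* Idea. The polynomial x^m - Phi_n(x), m = phi(n), has degree below m and unimodular values at the
   nodes, so Cond(V_n) >= |Phi_n(r)| - 1 for 0 < r < 1. Let n be the product of the first K primes
   and put G_n(u) = ln Phi_n(exp(-e^u)). From Phi_{np}(z) Phi_n(z) = Phi_n(z^p) one gets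
   G_{np}(u) = G_n(u + ln p) - G_n(u), so the Fourier transform of G_n at t is that of G_6 times the
   product of the factors p^{-it} - 1 over 5 <= p | n. Take t = pi / ln ln n: then p^{-it} is close
   to -1 for most p | n, and the product is almost 2^K. As G_n has integral 0 and decays like
   n^2 e^{-|u|}, this forces G_n(u) to exceed the size of the product up to a factor of order ln n.

   It remains to compare K with L / ln L, where L = ln n. The difference is (K ln L - L) / ln L, and
   the weak Chebyshev bound p_j <= 2 j ln p_K suffices for K ln L - L >= K / 4 because ln 2 < 3/4. The
   loss in the product is quadratic in 1 - ln p / ln L and hence of smaller order than K / ln L. *)

theory Submission
  imports Defs "HOL-Analysis.Analysis" "HOL-Real_Asymp.Real_Asymp"
begin

section \<open>Cyclotomic polynomials as products over primitive roots\<close>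

text \<open>Only values of Phi_n above 1 are of use, whereas a Fourier transform merely bounds the
  L^1 norm of G_n from below; the vanishing integral turns this into a large positive value. The
  substitution z = exp(-e^u) makes z -> z^p a translation by ln p, so that adjoining a prime becomes
  a difference operator. The recursion cannot start at 1 or 2, because ln |Phi_1| and ln Phi_2 do
  not tend to 0 as u -> -infinity and are not integrable in u. A factor p^{-it} - 1 equals -2
  exactly when t ln p is an odd multiple of pi; with t = pi / ln L this happens at p = L, and on the
  logarithmic scale most primes dividing n lie close to L. This frequency tends to 0, so the
  transform of G_6 there tends to the integral of G_6, which is nonzero because Phi_6 < 1 on (0,
  1).\<close>

lemma primitive_unity_roots_iff:
  assumes "0 < n"
  shows "z \<in> primitive_unity_roots n \<longleftrightarrow> (\<forall>k. z ^ k = 1 \<longleftrightarrow> n dvd k)"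
proof
  assume "z \<in> primitive_unity_roots n"
  hence zn: "z ^ n = 1" and z: "\<And>k. 0 < k \<Longrightarrow> k < n \<Longrightarrow> z ^ k \<noteq> 1"
    unfolding primitive_unity_roots_def by blast+
  show "\<forall>k. z ^ k = 1 \<longleftrightarrow> n dvd k"
  proof (intro allI iffI)
    fix k assume k: "z ^ k = 1"
    have "z ^ k = (z ^ n) ^ (k div n) * z ^ (k mod n)"
      by (simp flip: power_mult power_add)
    hence "z ^ (k mod n) = 1" using zn k by simp
    hence "\<not> 0 < k mod n" using z[of "k mod n"] mod_less_divisor[OF assms, of k] by argo
    thus "n dvd k" by (simp add: mod_eq_0_iff_dvd)
  next
    fix k assume "n dvd k"
    thus "z ^ k = 1" using zn by (elim dvdE) (simp add: power_mult)
  qed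
next
  assume z: "\<forall>k. z ^ k = 1 \<longleftrightarrow> n dvd k"
  have "z ^ k \<noteq> 1" if "0 < k" "k < n" for k
    using z nat_dvd_not_less[OF that] by blast
  moreover have "z ^ n = 1" using spec[OF z, of n] by simp
  ultimately show "z \<in> primitive_unity_roots n"
    unfolding primitive_unity_roots_def by (intro CollectI conjI allI impI) (assumption, elim conjE)
qed

lemma finite_primitive_unity_roots: "0 < n \<Longrightarrow> finite (primitive_unity_roots n)"
  by (rule finite_subset[OF _ finite_nth_roots[of n 1]]) (auto simp only: primitive_unity_roots_def)

text \<open>If \<open>w ^ p\<close> has order n, then \<open>w\<close> has order n or n p, and
  \<open>w ^ n = 1\<close> decides which. Disjointness later splits a product over all p-th roots
  into two cyclotomic values.\<close>

lemma primitive_unity_roots_mult_prime: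
  assumes "prime p" "\<not> p dvd n" "0 < n"
  shows "{w. w ^ p \<in> primitive_unity_roots n} = primitive_unity_roots (n * p) \<union> primitive_unity_roots n"
    and "primitive_unity_roots (n * p) \<inter> primitive_unity_roots n = {}"
proof -
  have p: "0 < p" "1 < p" using assms(1) prime_gt_0_nat prime_gt_1_nat by auto
  have cop: "coprime n p" using prime_imp_coprime[OF assms(1,2)] by (rule coprime_imp_coprime) auto
  note iff = primitive_unity_roots_iff[OF assms(3)] primitive_unity_roots_iff[of "n * p"]
  show "{w. w ^ p \<in> primitive_unity_roots n} = primitive_unity_roots (n * p) \<union> primitive_unity_roots n"
    (is "?A = ?B \<union> ?C")
  proof (intro equalityI subsetI)
    fix w assume "w \<in> ?A"
    hence w: "w ^ (p * k) = 1 \<longleftrightarrow> n dvd k" for k by (simp add: iff power_mult)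
    show "w \<in> ?B \<union> ?C"
    proof (cases "w ^ n = 1")
      case True
      have "w ^ k = 1 \<longleftrightarrow> n dvd k" for k
      proof
        assume "w ^ k = 1"
        hence "w ^ (p * k) = 1" by (simp add: power_mult mult.commute[of p])
        thus "n dvd k" using w by simp
      next
        assume "n dvd k"
        thus "w ^ k = 1" using True by (auto simp: power_mult)
      qed
      hence "w \<in> ?C" unfolding iff(1) by blast
      thus ?thesis ..
    next
      case False
      have "w ^ k = 1 \<longleftrightarrow> n * p dvd k" for k
      proof
        assume k: "w ^ k = 1"
        hence "w ^ (p * k) = 1" by (simp add: power_mult mult.commute[of p])
        hence nk: "n dvd k" using w by simp
        have "p dvd k"
        proof (rule ccontr)
          assume "\<not> p dvd k"
          hence "coprime p k" by (rule prime_imp_coprime[OF assms(1)])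
          hence "coprime k p" by (rule coprime_imp_coprime) auto
          \<comment> \<open>With k inverted modulo p, the exponent n is the difference of a multiple
            of k and n b p, both of which give 1; so \<open>w ^ n = 1\<close>, which this case
            excludes.\<close>
          then obtain a b where ab: "k * a = p * b + 1"
            using coprime_bezout_strong[of k p] p by auto
          have "w ^ (n * (k * a)) = w ^ (p * (n * b)) * w ^ n"
            unfolding ab by (simp add: algebra_simps power_add)
          moreover have "w ^ (n * (k * a)) = 1" 
            using k by (simp add: power_mult mult.left_commute[of n])
          moreover have "w ^ (p * (n * b)) = 1" using w by simp
          ultimately show False using False by simp
        qed
        thus "n * p dvd k" using nk cop by (simp add: divides_mult)
      next
        assume "n * p dvd k"
        then obtain c where "k = p * (n * c)" by (auto simp: dvd_def ac_simps)
        thus "w ^ k = 1" using w by simp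
      qed
      hence "w \<in> ?B" using p assms(3) by (subst iff(2)) auto
      thus ?thesis ..
    qed
  next
    fix w assume "w \<in> ?B \<union> ?C"
    thus "w \<in> ?A"
    proof
      assume "w \<in> ?B"
      hence "\<forall>k. w ^ k = 1 \<longleftrightarrow> n * p dvd k" using iff p assms by simp
      hence "\<forall>k. w ^ (p * k) = 1 \<longleftrightarrow> n dvd k" using p by (simp add: mult.commute[of n])
      thus "w \<in> ?A" by (simp add: iff power_mult)
    next
      assume "w \<in> ?C"
      hence "\<forall>k. w ^ k = 1 \<longleftrightarrow> n dvd k" using iff by simp
      hence "\<forall>k. w ^ (p * k) = 1 \<longleftrightarrow> n dvd k" using cop by (simp add: coprime_dvd_mult_right_iff)
      thus "w \<in> ?A" by (simp add: iff power_mult)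
    qed
  qed
  show "?B \<inter> ?C = {}"
  proof -
    have "\<not> n * p dvd n" using p assms by (auto dest: dvd_imp_le)
    moreover have "n * p dvd n" if "x \<in> ?B" "x \<in> ?C" for x
    proof -
      have "x ^ n = 1" "\<forall>k. x ^ k = 1 \<longleftrightarrow> n * p dvd k" using that iff p assms by simp_all
      thus ?thesis by blast
    qed
    ultimately show ?thesis by blast
  qed
qed

text \<open>Both sides are monic of degree p in z and vanish at the p roots of w^p = a, which are
  distinct because a is nonzero; their difference has degree below p, hence is 0.\<close>

lemma prod_nth_roots_diff:
  fixes a z :: complex
  assumes "a \<noteq> 0" "0 < p"
  shows "(\<Prod>w | w ^ p = a. z - w) = z ^ p - a"
proof -
  define S where "S = {w. w ^ p = a}"
  have fin: "finite S" and card: "card S = p"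
    unfolding S_def using finite_nth_roots[OF assms(2)] card_nth_roots[OF assms] by auto
  define P where "P = (\<Prod>w\<in>S. [:-w, 1:])"
  define Q where "Q = monom 1 p - [:a:]"
  have degP: "degree P = p" "lead_coeff P = 1"
    unfolding P_def using card by (simp add: degree_prod_sum_eq, simp only: lead_coeff_prod, simp)
  have "P = Q"
  proof (rule ccontr)
    assume "P \<noteq> Q"
    hence nz: "P - Q \<noteq> 0" by simp
    have "S \<subseteq> {x. poly (P - Q) x = 0}"
      unfolding P_def Q_def using fin by (auto simp: poly_prod poly_monom S_def)
    hence "p \<le> degree (P - Q)"
      using card card_poly_roots_bound[OF nz] card_mono[OF poly_roots_finite[OF nz], of S] by linarith
    moreover have "degree (P - Q) \<le> p - 1"
    proof (rule degree_le, intro allI impI)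
      fix i assume "p - 1 < i"
      hence i: "0 < i" "p \<le> i" by auto
      have "coeff [:a:] i = 0" using i by (cases i) auto
      moreover have "coeff P i = (if i = p then 1 else 0)"
        using degP i by (auto simp: coeff_eq_0)
      ultimately show "coeff (P - Q) i = 0" by (simp add: Q_def)
    qed
    ultimately show False using assms(2) by linarith
  qed
  hence "poly P z = poly Q z" by simp
  thus ?thesis by (simp add: P_def Q_def poly_prod poly_monom S_def)
qed

definition cyclotomic :: "nat \<Rightarrow> complex \<Rightarrow> complex" where
  "cyclotomic n z = (\<Prod>w\<in>primitive_unity_roots n. z - w)"

lemma cyclotomic_1: "cyclotomic 1 z = z - 1"
proof -
  have "primitive_unity_roots 1 = {1}" by (auto simp: primitive_unity_roots_def)
  thus ?thesis by (simp add: cyclotomic_def)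
qed

text \<open>Each factor z^p - a of the right side is the product of z - w over the p-th roots w of
  a; sorting these w by their order gives the two factors on the left.\<close>

lemma cyclotomic_mult_prime:
  assumes "prime p" "\<not> p dvd n" "0 < n"
  shows "cyclotomic (n * p) z * cyclotomic n z = cyclotomic n (z ^ p)"
proof -
  note p = prime_gt_0_nat[OF assms(1)]
  have nz: "w \<noteq> 0" if "w \<in> primitive_unity_roots n" for w
    using that assms(3) by (auto simp: primitive_unity_roots_def power_0_left)
  have "cyclotomic n (z ^ p) = (\<Prod>a\<in>primitive_unity_roots n. \<Prod>w | w ^ p = a. z - w)"
    unfolding cyclotomic_def using nz p by (intro prod.cong refl prod_nth_roots_diff[symmetric])
  also have "\<dots> = (\<Prod>w\<in>(\<Union>a\<in>primitive_unity_roots n. {w. w ^ p = a}). z - w)"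
    using assms(3) nz p
    by (intro prod.UNION_disjoint[symmetric] finite_primitive_unity_roots ballI finite_nth_roots) auto
  also have "(\<Union>a\<in>primitive_unity_roots n. {w. w ^ p = a}) = {w. w ^ p \<in> primitive_unity_roots n}"
    by auto
  also have "\<dots> = primitive_unity_roots (n * p) \<union> primitive_unity_roots n"
    by (rule primitive_unity_roots_mult_prime[OF assms])
  also have "(\<Prod>w\<in>\<dots>. z - w) = cyclotomic (n * p) z * cyclotomic n z"
    unfolding cyclotomic_def using assms p
    by (intro prod.union_disjoint finite_primitive_unity_roots primitive_unity_roots_mult_prime) auto
  finally show ?thesis ..
qed

text \<open>Obtained along 1 -> 2 -> 6 by the prime step. The excluded points are the zeros of the
  factors that get cancelled: x - 1 at x = z and at x = z^3, and z + 1.\<close>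

lemma cyclotomic_6:
  assumes "z \<noteq> 1" "z ^ 3 \<noteq> 1" "z \<noteq> -1"
  shows "cyclotomic 6 z = 1 - z + z ^ 2"
proof -
  have c2: "cyclotomic 2 x = x + 1" if "x \<noteq> 1" for x
  proof -
    have "cyclotomic 2 x * (x - 1) = x ^ 2 - 1"
      using cyclotomic_mult_prime[of 2 1 x] cyclotomic_1[of x] cyclotomic_1[of "x ^ 2"] by simp
    also have "\<dots> = (x + 1) * (x - 1)" by (simp add: power2_eq_square algebra_simps)
    finally show ?thesis using that by simp
  qed
  have "cyclotomic 6 z * (z + 1) = z ^ 3 + 1"
    using cyclotomic_mult_prime[of 3 2 z] c2[of z] c2[of "z ^ 3"] assms by simp
  also have "\<dots> = (1 - z + z ^ 2) * (z + 1)" by (simp add: power2_eq_square power3_eq_cube algebra_simps)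
  finally have "(cyclotomic 6 z - (1 - z + z ^ 2)) * (z + 1) = 0" by (simp add: algebra_simps)
  thus ?thesis using assms(3) by (auto simp: add_eq_0_iff2)
qed

section \<open>The condition number and values of cyclotomic polynomials\<close>

lemma frobenius_norm_eq:
  assumes "A \<in> carrier_mat m n"
  shows "frobenius_norm A = sqrt (\<Sum>i<m. \<Sum>j<n. (cmod (A $$ (i, j)))\<^sup>2)"
proof -
  have dims: "dim_row A = m" "dim_col A = n" using assms by auto
  have entry: "(mat_adjoint A * A) $$ (j, j) = (\<Sum>i<m. of_real ((cmod (A $$ (i, j)))\<^sup>2))"
    if j: "j < n" for j
  proof -
    have adj: "mat_adjoint A = Matrix.mat n m (\<lambda>(j, i). cnj (A $$ (i, j)))"
      unfolding mat_adjoint_def mat_of_rows_def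
      by (rule cong_mat) (simp_all add: dims)
    have "(mat_adjoint A * A) $$ (j, j) = Matrix.row (mat_adjoint A) j \<bullet> col A j"
      using j dims by (simp add: adj)
    also have "\<dots> = (\<Sum>i<m. cnj (A $$ (i, j)) * A $$ (i, j))"
      unfolding scalar_prod_def dim_col dims atLeast0LessThan
      using j dims by (intro sum.cong refl) (simp add: adj)
    also have "\<dots> = (\<Sum>i<m. of_real ((cmod (A $$ (i, j)))\<^sup>2))"
      by (intro sum.cong refl) (simp add: complex_norm_square mult.commute del: of_real_power)
    finally show ?thesis .
  qed
  have "mat_trace (mat_adjoint A * A) = (\<Sum>j<n. \<Sum>i<m. of_real ((cmod (A $$ (i, j)))\<^sup>2))"
    unfolding mat_trace_def using dims entry by (simp add: mat_adjoint_def)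
  also have "\<dots> = of_real (\<Sum>j<n. \<Sum>i<m. (cmod (A $$ (i, j)))\<^sup>2)" by simp
  finally have "Re (mat_trace (mat_adjoint A * A)) = (\<Sum>j<n. \<Sum>i<m. (cmod (A $$ (i, j)))\<^sup>2)"
    by (metis Re_complex_of_real)
  thus ?thesis unfolding frobenius_norm_def by (subst (asm) sum.swap) simp
qed

text \<open>Cauchy-Schwarz over the m^2 entries. The factor m is exactly the Frobenius norm of a
  Vandermonde matrix with unimodular nodes, so nothing is lost when passing to the condition
  number.\<close>

lemma sum_norm_entries_le_frobenius_norm:
  assumes "A \<in> carrier_mat m m"
  shows "(\<Sum>i<m. \<Sum>j<m. cmod (A $$ (i, j))) \<le> real m * frobenius_norm A"
proof -
  let ?f = "\<lambda>(i, j). cmod (A $$ (i, j))"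
  have "(\<Sum>i<m. \<Sum>j<m. cmod (A $$ (i, j)))\<^sup>2 = (\<Sum>x\<in>{..<m} \<times> {..<m}. ?f x)\<^sup>2"
    by (simp add: sum.cartesian_product)
  also have "\<dots> \<le> (\<Sum>x\<in>{..<m} \<times> {..<m}. (?f x)\<^sup>2) * card ({..<m} \<times> {..<m})"
    by (rule sum_squared_le_sum_of_squares)
  also have "\<dots> = (real m * frobenius_norm A)\<^sup>2"
    unfolding frobenius_norm_eq[OF assms]
    by (simp add: power_mult_distrib sum.cartesian_product sum_nonneg case_prod_unfold power2_eq_square[of "real m"])
  finally show ?thesis
    by (rule power2_le_imp_le) (simp add: frobenius_norm_eq[OF assms] sum_nonneg)
qed

text \<open>The coefficient vector c of x^m - P(x), where P has the nodes as its roots, satisfies V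
  c = (z_i^m), because P vanishes at the nodes. Hence c = B (z_i^m) with B the inverse of V, and
  each |c_j| is at most the absolute sum of row j of B.\<close>

lemma cyclotomic_le_condition_number:
  assumes n: "0 < n" and bij: "bij_betw z {..<totient n} (primitive_unity_roots n)"
    and w: "cmod w \<le> 1"
  shows "cmod (cyclotomic n w) - 1 \<le> condition_number (unity_vandermonde n z)"
proof -
  define m where "m = totient n"
  define V where "V = unity_vandermonde n z"
  have V: "V \<in> carrier_mat m m" and V_entry: "\<And>i j. i < m \<Longrightarrow> j < m \<Longrightarrow> V $$ (i, j) = z i ^ j"
    unfolding V_def unity_vandermonde_def m_def by auto
  have inj: "inj_on z {..<m}" using bij by (simp add: bij_betw_def m_def)
  have norm_z: "cmod (z i) = 1" if "i < m" for i
  proof -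
    have "z i ^ n = 1"
      using bij that unfolding m_def bij_betw_def primitive_unity_roots_def by auto
    thus ?thesis using power_eq_imp_eq_norm[of "z i" n 1] n by simp
  qed
  \<comment> \<open>A kernel vector would be the coefficient list of a nonzero polynomial of degree
    below m with m distinct roots.\<close>
  have det: "Determinant.det V \<noteq> 0"
  proof
    assume "Determinant.det V = 0"
    then obtain v where v: "v \<in> carrier_vec m" "v \<noteq> 0\<^sub>v m" "V *\<^sub>v v = 0\<^sub>v m"
      using det_0_iff_vec_prod_zero[OF V] by auto
    define q where "q = (\<Sum>j<m. monom (vec_index v j) j)"
    have coeff_q: "coeff q j = vec_index v j" if "j < m" for j
      unfolding q_def using that by (simp add: coeff_sum)
    have "z ` {..<m} \<subseteq> {x. poly q x = 0}"
    proof safe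
      fix i assume i: "i < m"
      have "poly q (z i) = (\<Sum>j<m. V $$ (i, j) * vec_index v j)"
        unfolding q_def using i by (simp add: poly_sum poly_monom V_entry mult.commute)
      also have "\<dots> = vec_index (V *\<^sub>v v) i"
        using i V v(1) by (simp add: scalar_prod_def atLeast0LessThan)
      finally show "poly q (z i) = 0" using v(3) i by simp
    qed
    moreover have "q \<noteq> 0"
    proof
      assume "q = 0"
      hence "v = 0\<^sub>v m" using coeff_q v(1) by (intro eq_vecI) auto
      thus False using v(2) by simp
    qed
    ultimately have "card (z ` {..<m}) \<le> degree q"
      using card_poly_roots_bound[of q] card_mono[OF poly_roots_finite[of q]] by (meson le_trans)
    moreover have "card (z ` {..<m}) = m" using inj by (simp add: card_image)
    moreover have "degree q < m"
    proof -
      have "m \<noteq> 0" using v(1,2) by auto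
      moreover have "degree q \<le> m - 1"
        unfolding q_def by (intro degree_sum_le) (auto intro: order_trans[OF degree_monom_le])
      ultimately show ?thesis by linarith
    qed
    ultimately show False by simp
  qed
  have "V \<in> Units (ring_mat TYPE(complex) m ())" by (rule det_non_zero_imp_unit[OF V det])
  then obtain B where B: "mat_inverse V = Some B"
    using mat_inverse(1)[OF V, of "()"] by (cases "mat_inverse V") auto
  have BV: "B * V = 1\<^sub>m m" and Bc: "B \<in> carrier_mat m m" using mat_inverse(2)[OF V B] by auto
  \<comment> \<open>All m^2 entries of V have modulus 1, so its Frobenius norm is m.\<close>
  have cond: "condition_number V = real m * frobenius_norm B"
    using V_entry norm_z unfolding condition_number_def frobenius_norm_eq[OF V] B
    by (simp add: norm_power real_sqrt_mult)
  define P where "P = (\<Prod>i<m. [:- z i, 1:])"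
  define c where "c j = coeff (monom 1 m - P) j" for j
  have degP: "degree P = m" "lead_coeff P = 1"
    unfolding P_def by (simp add: degree_prod_sum_eq, simp only: lead_coeff_prod, simp)
  have c0: "c j = 0" if "m \<le> j" for j
    using degP that by (cases "j = m") (auto simp: c_def coeff_eq_0)
  have polyc: "x ^ m - poly P x = (\<Sum>j<m. c j * x ^ j)" for x
  proof -
    have "x ^ m - poly P x = poly (monom 1 m - P) x" by (simp add: poly_monom)
    also have "\<dots> = (\<Sum>j\<le>degree (monom 1 m - P). c j * x ^ j)"
      unfolding c_def by (rule poly_altdef)
    also have "\<dots> = (\<Sum>j\<in>{..degree (monom 1 m - P)} \<union> {..<m}. c j * x ^ j)"
      by (intro sum.mono_neutral_left) (auto simp: c_def not_le simp del: coeff_diff intro!: coeff_eq_0)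
    also have "\<dots> = (\<Sum>j<m. c j * x ^ j)"
      using c0 by (intro sum.mono_neutral_right) (auto simp: not_less)
    finally show ?thesis .
  qed
  have "(\<Sum>j<m. cmod (c j)) \<le> (\<Sum>j<m. \<Sum>i<m. cmod (B $$ (j, i)))"
  proof (intro sum_mono)
    fix j assume "j \<in> {..<m}"
    hence j: "j < m" by simp
    define cv where "cv = Matrix.vec m c"
    have cv: "cv \<in> carrier_vec m" by (simp add: cv_def)
    have Vc: "vec_index (V *\<^sub>v cv) i = z i ^ m" if i: "i < m" for i
    proof -
      have "vec_index (V *\<^sub>v cv) i = (\<Sum>j<m. c j * z i ^ j)"
        using i V by (simp add: cv_def scalar_prod_def atLeast0LessThan V_entry mult.commute)
      also have "\<dots> = z i ^ m - poly P (z i)" by (rule polyc[symmetric])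
      also have "poly P (z i) = 0"
        unfolding P_def poly_prod using i by (intro prod_zero) auto
      finally show ?thesis by simp
    qed
    have "cv = B *\<^sub>v (V *\<^sub>v cv)"
      using BV cv assoc_mult_mat_vec[OF Bc V cv] by simp
    hence "c j = vec_index (B *\<^sub>v (V *\<^sub>v cv)) j" using j by (metis cv_def index_vec)
    also have "\<dots> = (\<Sum>i<dim_vec (V *\<^sub>v cv). B $$ (j, i) * vec_index (V *\<^sub>v cv) i)"
      using j Bc V by (simp add: scalar_prod_def atLeast0LessThan)
    also have "\<dots> = (\<Sum>i<m. B $$ (j, i) * z i ^ m)"
      using V Vc by (intro sum.cong) auto
    finally have "cmod (c j) \<le> (\<Sum>i<m. cmod (B $$ (j, i) * z i ^ m))"
      by (simp add: norm_sum)
    thus "cmod (c j) \<le> (\<Sum>i<m. cmod (B $$ (j, i)))"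
      using norm_z by (simp add: norm_mult norm_power)
  qed
  also have "\<dots> \<le> condition_number V"
    unfolding cond by (rule sum_norm_entries_le_frobenius_norm[OF Bc])
  finally have c_le: "(\<Sum>j<m. cmod (c j)) \<le> condition_number V" .
  have "cyclotomic n w = poly P w"
    unfolding cyclotomic_def P_def poly_prod m_def
    using prod.reindex_bij_betw[OF bij, of "\<lambda>x. w - x"] by simp
  also have "\<dots> = w ^ m - (\<Sum>j<m. c j * w ^ j)" using polyc[of w] by (simp add: algebra_simps)
  finally have "cmod (cyclotomic n w) \<le> cmod (w ^ m) + cmod (\<Sum>j<m. c j * w ^ j)"
    by (simp add: norm_triangle_ineq4)
  also have "cmod (w ^ m) \<le> 1" using w by (simp add: norm_power power_le_one)
  also have "cmod (\<Sum>j<m. c j * w ^ j) \<le> (\<Sum>j<m. cmod (c j))"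
    using w by (intro sum_norm_le) (simp add: norm_mult norm_power mult_left_le power_le_one)
  also note c_le
  finally show ?thesis unfolding V_def by simp
qed

section \<open>A Chebyshev bound for the sequence of primes\<close>

text \<open>The multiplicity of p in a least common multiple is a maximum, so the power already
  divides a single number up to N.\<close>

lemma prime_power_dvd_Lcm_le:
  fixes p :: nat
  assumes "prime p" "p ^ a dvd Lcm {1..N}" "0 < N"
  shows "p ^ a \<le> N"
  using assms(2,3)
proof (induction N)
  case (Suc N)
  have eq: "Lcm {1..Suc N} = lcm (Suc N) (Lcm {1..N})"
    by (simp add: atLeastAtMostSuc_conv)
  have nz: "Lcm {1..N} \<noteq> 0" by simp
  have m: "multiplicity p (Lcm {1..Suc N}) = max (multiplicity p (Suc N)) (multiplicity p (Lcm {1..N}))"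
    unfolding eq using nz assms(1) by (intro multiplicity_lcm) auto
  have "a \<le> multiplicity p (Lcm {1..Suc N})"
    using Suc.prems(1) assms(1) by (subst (asm) power_dvd_iff_le_multiplicity) auto
  hence "p ^ a dvd Suc N \<or> p ^ a dvd Lcm {1..N}"
    using m by (metis le_max_iff_disj multiplicity_dvd')
  thus ?case
  proof
    assume "p ^ a dvd Suc N" thus ?thesis by (rule dvd_imp_le) simp
  next
    assume d: "p ^ a dvd Lcm {1..N}"
    show ?thesis
    proof (cases "N = 0")
      case True
      hence "p ^ a dvd 1" using d by simp
      hence "p ^ a \<le> 1" by (intro dvd_imp_le) auto
      thus ?thesis by simp
    next
      case False thus ?thesis using Suc.IH d by simp
    qed
  qed
qed simp

lemma Lcm_le_power_card_primes:
  assumes "0 < N"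
  shows "Lcm {1..N} \<le> N ^ card {p::nat. prime p \<and> p \<le> N}"
proof -
  let ?D = "Lcm {1..N}"
  have nz: "?D \<noteq> 0" by simp
  have le: "p ^ multiplicity p ?D \<le> N" if "p \<in> prime_factors ?D" for p
    using that assms by (intro prime_power_dvd_Lcm_le multiplicity_dvd) auto
  have sub: "prime_factors ?D \<subseteq> {p::nat. prime p \<and> p \<le> N}"
  proof
    fix p assume p: "p \<in> prime_factors ?D"
    hence "p ^ 1 dvd ?D" "prime p" by auto
    thus "p \<in> {p. prime p \<and> p \<le> N}" using prime_power_dvd_Lcm_le[of p 1 N] assms by simp
  qed
  have "?D = (\<Prod>p\<in>prime_factors ?D. p ^ multiplicity p ?D)"
    using nz by (intro prime_factorization_nat) (simp only: neq0_conv)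
  also have "\<dots> \<le> (\<Prod>p\<in>prime_factors ?D. N)"
    using le by (intro prod_mono) auto
  also have "\<dots> = N ^ card (prime_factors ?D)" by simp
  also have "\<dots> \<le> N ^ card {p::nat. prime p \<and> p \<le> N}"
    using sub assms by (intro power_increasing card_mono) auto
  finally show ?thesis .
qed

text \<open>The integral of x^m (1 - x)^m over [0, 1] is a positive rational whose denominator
  divides the least common multiple, and it is at most 4^(-m).\<close>

lemma four_power_le_Lcm: "4 ^ m \<le> Lcm {1..2 * m + 1 :: nat}"
proof -
  let ?D = "Lcm {1..2 * m + 1 :: nat}"
  define F where "F x = (\<Sum>j\<le>m. (-1) ^ j * real (m choose j) * x ^ (m + j + 1) / real (m + j + 1))" for x :: real
  have deriv: "(F has_real_derivative x ^ m * (1 - x) ^ m) (at x)" for x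
  proof -
    have "x ^ m * (1 - x) ^ m = x ^ m * (\<Sum>j\<le>m. real (m choose j) * (-x) ^ j)"
      using binomial_ring[of "-x" 1 m] by simp
    also have "\<dots> = (\<Sum>j\<le>m. (-1) ^ j * real (m choose j) * x ^ (m + j))"
      unfolding sum_distrib_left
      by (intro sum.cong refl) (simp add: power_add power_minus[of x] mult_ac)
    finally have eq: "x ^ m * (1 - x) ^ m = (\<Sum>j\<le>m. (-1) ^ j * real (m choose j) * x ^ (m + j))" .
    show ?thesis
      unfolding F_def eq
    proof (intro DERIV_sum)
      fix j
      have "((\<lambda>x. x ^ (m + j + 1) / real (m + j + 1)) has_real_derivative x ^ (m + j)) (at x)"
        using DERIV_cdivide[OF DERIV_pow[of "m + j + 1" x UNIV], of "real (m + j + 1)"]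
        by (simp del: of_nat_add of_nat_Suc power_Suc)
      from DERIV_cmult[OF this, of "(-1) ^ j * real (m choose j)"]
      show "((\<lambda>x. (-1) ^ j * real (m choose j) * x ^ (m + j + 1) / real (m + j + 1)) has_real_derivative
          (-1) ^ j * real (m choose j) * x ^ (m + j)) (at x)"
        by (simp only: times_divide_eq_right)
    qed
  qed
  \<comment> \<open>\<open>F\<close> is the antiderivative read off the binomial expansion. The mean
    value theorem replaces the integral: a single point yields both positivity and the bound
    (1/4)^m.\<close>
  obtain \<xi> where \<xi>: "0 < \<xi>" "\<xi> < 1" "F 1 - F 0 = (1 - 0) * (\<xi> ^ m * (1 - \<xi>) ^ m)"
    using MVT2[of 0 1 F "\<lambda>x. x ^ m * (1 - x) ^ m"] deriv by auto
  have F0: "F 0 = 0" by (simp add: F_def)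
  have F1: "F 1 = (\<xi> * (1 - \<xi>)) ^ m" using \<xi> F0 by (simp add: power_mult_distrib)
  have "\<xi> * (1 - \<xi>) \<le> 1 / 4"
    using zero_le_power2[of "\<xi> - 1/2"] by (simp add: power2_eq_square algebra_simps)
  hence ub: "F 1 \<le> (1 / 4) ^ m" unfolding F1 using \<xi> by (intro power_mono) auto
  have pos: "F 1 > 0" unfolding F1 using \<xi> by simp
  \<comment> \<open>The integer obtained by clearing denominators in \<open>F 1\<close>; being
    positive, it is at least 1.\<close>
  define Z where "Z = (\<Sum>j\<le>m. (-1) ^ j * int (m choose j) * int (?D div (m + j + 1)))"
  have "real_of_int Z = real ?D * F 1"
  proof -
    have "real ?D / real (m + j + 1) = real (?D div (m + j + 1))" if "j \<le> m" for j
      using that by (intro real_of_nat_div[symmetric] dvd_Lcm) auto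
    hence "real ?D * ((-1) ^ j * real (m choose j) * 1 ^ (m + j + 1) / real (m + j + 1))
      = (-1) ^ j * real (m choose j) * real (?D div (m + j + 1))" if "j \<le> m" for j
      using that by (metis (no_types, lifting) mult.commute mult.right_neutral power_one times_divide_eq_left)
    thus ?thesis unfolding Z_def F_def sum_distrib_left by (simp del: of_nat_add)
  qed
  moreover have "?D \<noteq> 0" by simp
  hence "real ?D > 0" by (simp only: neq0_conv of_nat_0_less_iff)
  ultimately have "Z > 0" using pos by (metis mult_pos_pos of_int_0_less_iff)
  hence "1 \<le> real ?D * F 1" using \<open>real_of_int Z = _\<close> by linarith
  also have "\<dots> \<le> real ?D * (1 / 4) ^ m" using ub by (intro mult_left_mono) auto
  finally have "4 ^ m \<le> real ?D" by (simp add: power_divide field_simps)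
  thus ?thesis by (metis of_nat_le_iff of_nat_numeral of_nat_power)
qed

text \<open>Indexed from 0, so the first k primes are those with j < k, and \<open>Suc j\<close>
  primes are at most \<open>nth_prime j\<close>.\<close>

definition nth_prime :: "nat \<Rightarrow> nat" where
  "nth_prime = enumerate {p. prime p}"

lemma prime_nth_prime: "prime (nth_prime j)"
  using enumerate_in_set[OF primes_infinite, of j] by (simp add: nth_prime_def)

lemma strict_mono_nth_prime: "strict_mono nth_prime"
  unfolding nth_prime_def by (rule strict_mono_enumerate[OF primes_infinite])

lemma range_nth_prime: "range nth_prime = {p. prime p}"
  unfolding nth_prime_def by (rule range_enumerate[OF primes_infinite])

lemma nth_prime_less_iff [simp]: "nth_prime i < nth_prime j \<longleftrightarrow> i < j"
  by (rule strict_mono_less[OF strict_mono_nth_prime])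

lemma nth_prime_le_iff [simp]: "nth_prime i \<le> nth_prime j \<longleftrightarrow> i \<le> j"
  by (rule strict_mono_less_eq[OF strict_mono_nth_prime])

lemma nth_prime_eqI: 
  assumes "prime p" "card {q. prime q \<and> q < p} = j"
  shows "nth_prime j = p"
proof -
  obtain i where i: "p = nth_prime i" using range_nth_prime assms(1) by blast
  have "{q. prime q \<and> q < p} = {q \<in> range nth_prime. q < nth_prime i}"
    unfolding i range_nth_prime by simp
  also have "\<dots> = nth_prime ` {j. nth_prime j < nth_prime i}" by blast
  also have "\<dots> = nth_prime ` {..<i}" by (simp add: lessThan_def)
  finally have "{q. prime q \<and> q < p} = nth_prime ` {..<i}" .
  hence "card {q. prime q \<and> q < p} = i"
    using strict_mono_nth_prime by (simp add: card_image strict_mono_imp_inj_on inj_on_subset)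
  thus ?thesis using assms(2) i by simp
qed

lemma card_primes_le_nth_prime: "card {p. prime p \<and> p \<le> nth_prime j} = Suc j"
proof -
  have "{p. prime p \<and> p \<le> nth_prime j} = {p \<in> range nth_prime. p \<le> nth_prime j}"
    unfolding range_nth_prime by simp
  also have "\<dots> = nth_prime ` {i. nth_prime i \<le> nth_prime j}" by blast
  also have "\<dots> = nth_prime ` {..j}" by (simp add: atMost_def)
  finally have "{p. prime p \<and> p \<le> nth_prime j} = nth_prime ` {..j}" .
  thus ?thesis
    using strict_mono_nth_prime by (simp add: card_image strict_mono_imp_inj_on inj_on_subset)
qed

lemma nth_prime_ge: "j + 2 \<le> nth_prime j"
proof (induction j)
  case 0 show ?case using prime_ge_2_nat[OF prime_nth_prime[of 0]] by simp
next
  case (Suc j)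
  have "nth_prime j < nth_prime (Suc j)" unfolding nth_prime_less_iff by simp
  thus ?case using Suc by linarith
qed

lemma nth_prime_0: "nth_prime 0 = 2"
proof (rule nth_prime_eqI)
  have "{q::nat. prime q \<and> q < 2} = {}" by (auto dest: prime_ge_2_nat)
  thus "card {q::nat. prime q \<and> q < 2} = 0" by simp
qed simp

lemma nth_prime_1: "nth_prime (Suc 0) = 3"
proof (rule nth_prime_eqI)
  have "{q::nat. prime q \<and> q < 3} = {2}" by (auto dest: prime_ge_2_nat)
  thus "card {q::nat. prime q \<and> q < 3} = Suc 0" by simp
qed simp

text \<open>For p = 2m + 1 the two bounds on the least common multiple give 4^m <= p^(j+1). Index 0
  is excluded because 2 > 2 ln 2.\<close>

lemma nth_prime_le_ln:
  assumes "1 \<le> j"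
  shows "real (nth_prime j) \<le> 2 * real (Suc j) * ln (real (nth_prime j))"
proof -
  let ?p = "nth_prime j"
  have p3: "3 \<le> ?p" using nth_prime_ge[of j] assms by simp
  have ln3: "1 \<le> ln (real ?p)"
    using p3 exp_le by (subst ln_ge_iff) auto
  show ?thesis
  proof (cases "?p = 3")
    case True
    have "3 \<le> 2 * real (Suc j) * 1" using assms by simp
    also have "\<dots> \<le> 2 * real (Suc j) * ln (real ?p)" using ln3 by (intro mult_left_mono) auto
    finally show ?thesis using True by simp
  next
    case False
    hence p4: "4 \<le> real ?p" using p3 by simp
    have "odd ?p" using prime_odd_nat[OF prime_nth_prime] p3 by simp
    then obtain m where m: "?p = 2 * m + 1" by (elim oddE)
    have "4 ^ m \<le> Lcm {1..?p}" using four_power_le_Lcm[of m] by (simp only: m)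
    also have "\<dots> \<le> ?p ^ Suc j"
      using Lcm_le_power_card_primes[of ?p] p3 unfolding card_primes_le_nth_prime by linarith
    finally have "real (4 ^ m) \<le> real (?p ^ Suc j)" by (simp only: of_nat_le_iff)
    hence "ln (4 ^ m) \<le> ln (real ?p ^ Suc j)" using p3 by (subst ln_le_cancel_iff) auto
    also have "ln (real ?p ^ Suc j) = real (Suc j) * ln (real ?p)" by (rule ln_realpow)
    also have "ln (4 ^ m) = real m * ln (4::real)" by (rule ln_realpow)
    finally have "real m * ln 4 \<le> real (Suc j) * ln (real ?p)" .
    moreover have "ln (4::real) = 2 * ln 2" using ln_realpow[of 2 2] by simp
    ultimately have "(real ?p - 1) * ln 2 \<le> real (Suc j) * ln (real ?p)" using m by simp
    moreover have "(real ?p - 1) * (2 / 3) \<le> (real ?p - 1) * ln 2"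
      using ln2_ge_two_thirds p4 by (intro mult_left_mono) auto
    \<comment> \<open>(x - 1) * 2/3 is at least x/2 precisely from x = 4 on, which is why p = 3 is
      treated separately.\<close>
    moreover have "x \<le> 2 * X" if "Y \<le> X" "(x - 1) * (2 / 3) \<le> Y" "4 \<le> x" for x X Y :: real
      using that by argo
    ultimately have "real ?p \<le> 2 * (real (Suc j) * ln (real ?p))" using p4 by blast
    thus ?thesis by (simp only: mult.assoc)
  qed
qed

text \<open>With the logarithm taken at a larger prime, one constant serves for all j <= k, index 0
  included, and summing ln p_j reduces to summing ln (j + 1).\<close>

lemma nth_prime_le:
  assumes "j \<le> k" "1 \<le> k"
  shows "real (nth_prime j) \<le> 2 * real (Suc j) * ln (real (nth_prime k))"
proof (cases "j = 0")
  case True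
  have "3 \<le> nth_prime k" using nth_prime_ge[of k] assms by simp
  hence "1 \<le> ln (real (nth_prime k))" using exp_le by (subst ln_ge_iff) auto
  thus ?thesis using True by (simp add: nth_prime_0)
next
  case False
  hence "real (nth_prime j) \<le> 2 * real (Suc j) * ln (real (nth_prime j))" by (intro nth_prime_le_ln) simp
  also have "\<dots> \<le> 2 * real (Suc j) * ln (real (nth_prime k))"
    using assms prime_gt_0_nat[OF prime_nth_prime] by (intro mult_left_mono) auto
  finally show ?thesis .
qed

section \<open>Fourier transforms of iterated differences\<close>

text \<open>Step k shifts by \<open>a k\<close>; with \<open>a\<close> listing logarithms of
  successive primes, it mirrors adjoining one prime at a time to n.\<close>

primrec iterated_difference :: "(real \<Rightarrow> real) \<Rightarrow> (nat \<Rightarrow> real) \<Rightarrow> nat \<Rightarrow> real \<Rightarrow> real" where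
  "iterated_difference f a 0 = f"
| "iterated_difference f a (Suc k) =
     (\<lambda>u. iterated_difference f a k (u + a k) - iterated_difference f a k u)"

lemma integrable_iterated_difference:
  assumes "integrable lborel f"
  shows "integrable lborel (iterated_difference f a k)"
proof (induction k)
  case (Suc k)
  have "integrable lborel (\<lambda>u. iterated_difference f a k (a k + 1 * u))"
    by (rule lborel_integrable_real_affine[OF Suc]) simp
  thus ?case using Suc by (auto intro!: Bochner_Integration.integrable_diff simp: add.commute)
qed (simp add: assms)

lemma integrable_mult_cis:
  assumes "integrable lborel f"
  shows "integrable lborel (\<lambda>u. complex_of_real (f u) * cis (t * u))"
proof (rule Bochner_Integration.integrable_bound)
  show "integrable lborel f" by fact
  show "(\<lambda>u. complex_of_real (f u) * cis (t * u)) \<in> borel_measurable lborel"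
  proof -
    have [measurable]: "f \<in> borel_measurable borel" using borel_measurable_integrable[OF assms] by simp
    have [measurable]: "(\<lambda>u. cis (t * u)) \<in> borel_measurable borel"
      by (intro borel_measurable_continuous_onI continuous_intros)
    show ?thesis by measurable
  qed
qed (simp add: norm_mult)

text \<open>Translating the function by \<open>a k\<close> multiplies its transform by
  \<open>cis (- (t * a k))\<close>, so every difference contributes one scalar factor.\<close>

lemma fourier_iterated_difference:
  assumes f: "integrable lborel f"
  shows "(\<integral>u. complex_of_real (iterated_difference f a k u) * cis (t * u) \<partial>lborel) =
           (\<Prod>j<k. cis (- (t * a j)) - 1) * (\<integral>u. complex_of_real (f u) * cis (t * u) \<partial>lborel)"
proof (induction k)
  case (Suc k)
  let ?G = "iterated_difference f a k"
  have int: "integrable lborel (\<lambda>u. complex_of_real (?G u) * cis (t * u))"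
    by (rule integrable_mult_cis[OF integrable_iterated_difference[OF f]])
  have eq: "complex_of_real (?G (u + a k)) * cis (t * u) =
      cis (- (t * a k)) * (complex_of_real (?G (a k + 1 * u)) * cis (t * (a k + 1 * u)))" for u
  proof -
    have "cis (t * u) = cis (- (t * a k)) * cis (t * (a k + 1 * u))"
      by (simp add: cis_mult algebra_simps)
    thus ?thesis by (simp add: add.commute mult_ac)
  qed
  have int': "integrable lborel (\<lambda>u. complex_of_real (?G (a k + 1 * u)) * cis (t * (a k + 1 * u)))"
    by (rule lborel_integrable_real_affine[OF int]) simp
  have shift: "(\<integral>u. complex_of_real (?G (a k + 1 * u)) * cis (t * (a k + 1 * u)) \<partial>lborel) =
      (\<integral>u. complex_of_real (?G u) * cis (t * u) \<partial>lborel)"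
    using lborel_integral_real_affine[of 1 "\<lambda>u. complex_of_real (?G u) * cis (t * u)" "a k"] by simp
  have "(\<integral>u. complex_of_real (iterated_difference f a (Suc k) u) * cis (t * u) \<partial>lborel) =
      (\<integral>u. cis (- (t * a k)) * (complex_of_real (?G (a k + 1 * u)) * cis (t * (a k + 1 * u)))
           - complex_of_real (?G u) * cis (t * u) \<partial>lborel)"
    by (simp only: iterated_difference.simps of_real_diff left_diff_distrib eq)
  also have "\<dots> = cis (- (t * a k)) * (\<integral>u. complex_of_real (?G u) * cis (t * u) \<partial>lborel)
      - (\<integral>u. complex_of_real (?G u) * cis (t * u) \<partial>lborel)"
    using int int' shift
    by (subst Bochner_Integration.integral_diff)
       (simp_all only: integrable_mult_right integral_mult_right_zero)
  also have "\<dots> = (cis (- (t * a k)) - 1) * (\<integral>u. complex_of_real (?G u) * cis (t * u) \<partial>lborel)"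
    by (simp add: algebra_simps)
  also have "\<dots> = (\<Prod>j<Suc k. cis (- (t * a j)) - 1) * (\<integral>u. complex_of_real (f u) * cis (t * u) \<partial>lborel)"
    unfolding Suc prod.lessThan_Suc by (simp only: mult_ac)
  finally show ?case .
qed simp

text \<open>As |u + a| >= |u| - a, a shift weakens the decay by at most the factor exp a, and the
  unshifted term adds 1.\<close>

lemma iterated_difference_bound:
  assumes "\<And>u. \<bar>f u\<bar> \<le> B * exp (- \<bar>u\<bar>)" "\<And>j. 0 \<le> a j" "0 \<le> B"
  shows "\<bar>iterated_difference f a k u\<bar> \<le> B * (\<Prod>j<k. exp (a j) + 1) * exp (- \<bar>u\<bar>)"
proof (induction k arbitrary: u)
  case (Suc k)
  let ?P = "B * (\<Prod>j<k. exp (a j) + 1)"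
  have P: "0 \<le> ?P" using assms(3) by (intro mult_nonneg_nonneg prod_nonneg) (auto intro: add_nonneg_nonneg)
  have "\<bar>iterated_difference f a (Suc k) u\<bar>
      \<le> ?P * exp (- \<bar>u + a k\<bar>) + ?P * exp (- \<bar>u\<bar>)"
    using Suc[of "u + a k"] Suc[of u] by simp
  also have "exp (- \<bar>u + a k\<bar>) \<le> exp (a k) * exp (- \<bar>u\<bar>)"
    using assms(2)[of k] by (simp flip: exp_add)
  hence "?P * exp (- \<bar>u + a k\<bar>) + ?P * exp (- \<bar>u\<bar>)
      \<le> ?P * (exp (a k) * exp (- \<bar>u\<bar>)) + ?P * exp (- \<bar>u\<bar>)"
    using P by (intro add_mono mult_left_mono) auto
  also have "\<dots> = B * (\<Prod>j<Suc k. exp (a j) + 1) * exp (- \<bar>u\<bar>)"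
    by (simp add: algebra_simps)
  finally show ?case .
qed (use assms in simp)

lemma integrable_exp_neg_abs:
  assumes "0 < c"
  shows "integrable lborel (\<lambda>u::real. exp (- c * \<bar>u\<bar>))"
proof -
  define g where "g u = indicator {0..} u * exp (- c * u)" for u :: real
  have "(\<integral>\<^sup>+u. ennreal (exp (- c * u)) * indicator {0..} u \<partial>lborel) = ennreal (0 - (- exp (- c * 0) / c))"
  proof (rule nn_integral_FTC_atLeast[where F = "\<lambda>u. - exp (- c * u) / c"])
    show "((\<lambda>u. - exp (- c * u) / c) \<longlongrightarrow> 0) at_top"
      using assms by real_asymp
  qed (use assms in \<open>auto intro!: derivative_eq_intros\<close>)
  moreover have "(\<integral>\<^sup>+u. ennreal (norm (g u)) \<partial>lborel) =
      (\<integral>\<^sup>+u. ennreal (exp (- c * u)) * indicator {0..} u \<partial>lborel)"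
    by (intro nn_integral_cong) (auto simp: g_def indicator_def)
  ultimately have "(\<integral>\<^sup>+u. ennreal (norm (g u)) \<partial>lborel) < \<infinity>"
    by simp
  moreover have "g \<in> borel_measurable lborel" unfolding g_def by measurable
  ultimately have g: "integrable lborel g"
    by (intro integrableI_bounded)
  hence g': "integrable lborel (\<lambda>u. g (0 + (-1) * u))"
    by (rule lborel_integrable_real_affine) simp
  have "integrable lborel (\<lambda>u. g u + g (0 + (-1) * u))"
    using g g' by (rule Bochner_Integration.integrable_add)
  thus ?thesis
    by (rule Bochner_Integration.integrable_bound) (auto simp: g_def indicator_def)
qed

text \<open>Integral zero makes the L^1 norm twice the integral of the positive part (|G| + G) / 2.
  That part is at most M on [-U, U]; outside, half of the exponential decay is spent on the factor
  exp(-U/2) and the other half on integrability.\<close>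

lemma integral_abs_le_of_upper_bound:
  fixes G :: "real \<Rightarrow> real"
  assumes G: "integrable lborel G" and zero: "(\<integral>u. G u \<partial>lborel) = 0"
    and decay: "\<And>u. \<bar>G u\<bar> \<le> A * exp (- \<bar>u\<bar>)" and ub: "\<And>u. G u \<le> M"
    and nonneg: "0 \<le> A" "0 \<le> M" "0 \<le> U"
  shows "(\<integral>u. \<bar>G u\<bar> \<partial>lborel) \<le>
    4 * U * M + 2 * A * exp (- U / 2) * (\<integral>u. exp (- \<bar>u\<bar> / 2) \<partial>lborel)"
proof -
  let ?h = "\<lambda>u. M * indicator {-U..U} u + A * exp (- U / 2) * exp (- \<bar>u\<bar> / 2)"
  have exp_int: "integrable lborel (\<lambda>u::real. exp (- \<bar>u\<bar> / 2))"
    using integrable_exp_neg_abs[of "1/2"] by simp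
  have ind_int: "integrable lborel (\<lambda>u::real. M * indicator {-U..U} u)"
    using nonneg by (intro integrable_mult_right integrable_real_indicator) (auto simp: emeasure_lborel_Icc)
  have le: "(\<bar>G u\<bar> + G u) / 2 \<le> ?h u" for u
  proof (cases "\<bar>u\<bar> \<le> U")
    case True
    hence "u \<in> {-U..U}" by auto
    moreover have "(\<bar>G u\<bar> + G u) / 2 \<le> M" using ub[of u] nonneg by (simp add: abs_if)
    ultimately show ?thesis using nonneg by (simp add: add_increasing2)
  next
    case False
    hence "u \<notin> {-U..U}" by auto
    have "(\<bar>G u\<bar> + G u) / 2 \<le> A * exp (- \<bar>u\<bar>)" using decay[of u] abs_ge_self[of "G u"] by (simp add: field_simps)
    also have "\<dots> \<le> A * exp (- U / 2 + - \<bar>u\<bar> / 2)"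
      using False nonneg by (intro mult_left_mono) auto
    finally show ?thesis using \<open>u \<notin> _\<close> unfolding exp_add by (simp add: mult.assoc)
  qed
  have "(\<integral>u. \<bar>G u\<bar> \<partial>lborel) = 2 * (\<integral>u. (\<bar>G u\<bar> + G u) / 2 \<partial>lborel)"
    using G zero by simp
  also have "(\<integral>u. (\<bar>G u\<bar> + G u) / 2 \<partial>lborel) \<le> (\<integral>u. ?h u \<partial>lborel)"
    using G le exp_int ind_int by (intro integral_mono) auto
  also have "(\<integral>u. ?h u \<partial>lborel) = M * (2 * U) + A * exp (- U / 2) * (\<integral>u. exp (- \<bar>u\<bar> / 2) \<partial>lborel)"
    using exp_int ind_int nonneg by (subst Bochner_Integration.integral_add) auto
  finally show ?thesis by (simp add: algebra_simps)
qed

lemma norm_cis_minus_1: "cmod (cis (- x) - 1) = 2 * \<bar>sin (x / 2)\<bar>"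
proof -
  have "(cmod (cis (- x) - 1))\<^sup>2 = (cos x - 1)\<^sup>2 + (sin x)\<^sup>2"
    by (simp add: cmod_power2)
  also have "\<dots> = 2 - 2 * cos x"
    using sin_cos_squared_add[of x] by (simp add: power2_eq_square algebra_simps)
  also have "\<dots> = (2 * \<bar>sin (x / 2)\<bar>)\<^sup>2"
    using cos_double_sin[of "x / 2"] by (simp add: power2_eq_square)
  finally show ?thesis by (rule power2_eq_imp_eq) auto
qed

text \<open>The Fourier transform turns differences into the factors \<open>cis (- t a\<^sub>j) - 1\<close>; since \<open>G\<close> has
  integral zero, its \<open>L\<^sup>1\<close> norm is controlled by an upper bound on \<open>G\<close> alone.\<close>

lemma iterated_difference_upper_bound_imp:
  assumes f: "integrable lborel f" and decay: "\<And>u. \<bar>f u\<bar> \<le> B * exp (- \<bar>u\<bar>)"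
    and a: "\<And>j. 0 \<le> a j" and k: "0 < k" and nonneg: "0 \<le> B" "0 \<le> M" "0 \<le> U"
    and ub: "\<And>u. iterated_difference f a k u \<le> M"
  shows "(\<Prod>j<k. 2 * \<bar>sin (t * a j / 2)\<bar>) * \<bar>\<integral>u. f u * cos (t * u) \<partial>lborel\<bar> \<le>
    4 * U * M + 2 * (B * (\<Prod>j<k. exp (a j) + 1)) * exp (- U / 2) * (\<integral>u. exp (- \<bar>u\<bar> / 2) \<partial>lborel)"
proof -
  let ?G = "iterated_difference f a k"
  note int = integrable_mult_cis[OF f, of t]
  \<comment> \<open>The integral is the transform at frequency 0, where every factor
    \<open>cis 0 - 1\<close> vanishes; one factor must be present, hence
    \<open>0 < k\<close>.\<close>
  have "complex_of_real (\<integral>u. ?G u \<partial>lborel) = (\<Prod>j<k. 0) * complex_of_real (\<integral>u. f u \<partial>lborel)"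
    using fourier_iterated_difference[OF f, of a k 0] by simp
  hence zero: "(\<integral>u. ?G u \<partial>lborel) = 0" using k by (simp add: power_0_left)
  have Re: "Re (\<integral>u. complex_of_real (f u) * cis (t * u) \<partial>lborel) = (\<integral>u. f u * cos (t * u) \<partial>lborel)"
    using integral_Re[OF int] by simp
  have "(\<Prod>j<k. 2 * \<bar>sin (t * a j / 2)\<bar>) * \<bar>\<integral>u. f u * cos (t * u) \<partial>lborel\<bar>
     \<le> cmod (\<Prod>j<k. cis (- (t * a j)) - 1) * cmod (\<integral>u. complex_of_real (f u) * cis (t * u) \<partial>lborel)"
    unfolding prod_norm[symmetric] norm_cis_minus_1 Re[symmetric]
    by (intro mult_left_mono abs_Re_le_cmod prod_nonneg) auto
  also have "\<dots> = cmod (\<integral>u. complex_of_real (?G u) * cis (t * u) \<partial>lborel)"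
    unfolding fourier_iterated_difference[OF f] norm_mult ..
  also have "\<dots> \<le> (\<integral>u. \<bar>?G u\<bar> \<partial>lborel)"
    using integral_norm_bound[of lborel "\<lambda>u. complex_of_real (?G u) * cis (t * u)"] by (simp add: norm_mult)
  also have "\<dots> \<le> 4 * U * M + 2 * (B * (\<Prod>j<k. exp (a j) + 1)) * exp (- U / 2) * (\<integral>u. exp (- \<bar>u\<bar> / 2) \<partial>lborel)"
    using iterated_difference_bound[of f B a, OF decay a] nonneg ub
    by (intro integral_abs_le_of_upper_bound integrable_iterated_difference f zero)
       (auto intro!: mult_nonneg_nonneg prod_nonneg add_nonneg_nonneg)
  finally show ?thesis .
qed

text \<open>This is ln Phi_6(z) at z = exp(-e^u). Since Phi_6 equals 1 at both z = 0 and z = 1, it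
  tends to 0 at both ends of the line.\<close>

definition log_cyclotomic_6 :: "real \<Rightarrow> real" where
  "log_cyclotomic_6 u = ln (1 - exp (- exp u) + exp (- exp u) ^ 2)"

text \<open>With y = z (1 - z), which lies in (0, 1/4], the function is ln (1 - y), of size at most
  2 y. The factor z decays for u -> infinity and 1 - z for u -> -infinity.\<close>

lemma log_cyclotomic_6_neg: "log_cyclotomic_6 u < 0"
  and log_cyclotomic_6_bound: "\<bar>log_cyclotomic_6 u\<bar> \<le> 2 * exp (- \<bar>u\<bar>)"
proof -
  define x where "x = exp u"
  define z where "z = exp (- x)"
  define y where "y = z * (1 - z)"
  have x: "0 < x" by (simp add: x_def)
  have z: "0 < z" "z < 1" using x by (simp_all add: z_def)
  have y: "0 < y" using z by (simp add: y_def)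
  have y4: "y \<le> 1 / 4"
    using zero_le_power2[of "z - 1/2"] by (simp add: y_def power2_eq_square algebra_simps)
  have eq: "log_cyclotomic_6 u = ln (1 - y)"
    by (simp add: log_cyclotomic_6_def x_def z_def y_def algebra_simps power2_eq_square)
  show "log_cyclotomic_6 u < 0" using y y4 by (simp add: eq)
  have "- ln (1 - y) = ln (1 / (1 - y))" using y4 by (simp add: ln_div)
  also have "\<dots> \<le> 1 / (1 - y) - 1" using y4 by (intro ln_le_minus_one) simp
  also have "\<dots> = y / (1 - y)" using y4 by (simp add: field_simps)
  also have "\<dots> \<le> y / (1 / 2)" using y y4 by (intro divide_left_mono) auto
  finally have 1: "\<bar>log_cyclotomic_6 u\<bar> \<le> 2 * y" using y y4 by (simp add: eq abs_if)
  have "y \<le> exp (- \<bar>u\<bar>)"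
  proof (cases "0 \<le> u")
    case True
    have "y \<le> z" using z by (simp add: y_def algebra_simps)
    also have "u \<le> x" using exp_ge_add_one_self[of u] unfolding x_def by linarith
    hence "z \<le> exp (- u)" by (simp add: z_def)
    finally show ?thesis using True by simp
  next
    case False
    have "y \<le> 1 * (1 - z)" unfolding y_def using z by (intro mult_right_mono) auto
    also have "1 - z \<le> x" using exp_ge_add_one_self[of "-x"] by (simp add: z_def)
    finally show ?thesis using False by (simp add: x_def)
  qed
  with 1 show "\<bar>log_cyclotomic_6 u\<bar> \<le> 2 * exp (- \<bar>u\<bar>)" by linarith
qed

lemma continuous_log_cyclotomic_6: "continuous_on UNIV log_cyclotomic_6"
proof -
  have "1 - z + z ^ 2 \<noteq> 0" for z :: real
  proof -
    have "1 - z + z ^ 2 = (z - 1/2) ^ 2 + 3 / 4" by (simp add: power2_eq_square algebra_simps)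
    thus ?thesis using zero_le_power2[of "z - 1/2"] by linarith
  qed
  thus ?thesis unfolding log_cyclotomic_6_def[abs_def] by (intro continuous_intros) auto
qed

lemma integrable_log_cyclotomic_6: "integrable lborel log_cyclotomic_6"
proof (rule Bochner_Integration.integrable_bound)
  show "integrable lborel (\<lambda>u::real. 2 * exp (- 1 * \<bar>u\<bar>))"
    by (intro integrable_mult_right integrable_exp_neg_abs) simp
  show "log_cyclotomic_6 \<in> borel_measurable lborel"
    using borel_measurable_continuous_onI[OF continuous_log_cyclotomic_6] by simp
qed (use log_cyclotomic_6_bound in simp)

text \<open>Dominated convergence sends the cosine transform to the full integral, which is nonzero
  because the integrand has constant sign.\<close>

lemma log_cyclotomic_6_cos_integral_away_from_0:
  assumes t: "t \<longlonglongrightarrow> (0::real)"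
  obtains c where "0 < c"
    "eventually (\<lambda>k::nat. c \<le> \<bar>\<integral>u. log_cyclotomic_6 u * cos (t k * u) \<partial>lborel\<bar>) sequentially"
proof -
  let ?I = "\<integral>u. log_cyclotomic_6 u \<partial>lborel"
  have meas [measurable]: "log_cyclotomic_6 \<in> borel_measurable borel"
    by (rule borel_measurable_continuous_onI[OF continuous_log_cyclotomic_6])
  have "(\<lambda>k. \<integral>u. log_cyclotomic_6 u * cos (t k * u) \<partial>lborel) \<longlonglongrightarrow> ?I"
  proof (rule integral_dominated_convergence[where w = "\<lambda>u. \<bar>log_cyclotomic_6 u\<bar>"])
    show "integrable lborel (\<lambda>u. \<bar>log_cyclotomic_6 u\<bar>)" using integrable_log_cyclotomic_6 by simp
    show "AE u in lborel. (\<lambda>k. log_cyclotomic_6 u * cos (t k * u)) \<longlonglongrightarrow> log_cyclotomic_6 u"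
    proof (rule AE_I2)
      fix u
      have "(\<lambda>k. log_cyclotomic_6 u * cos (t k * u)) \<longlonglongrightarrow> log_cyclotomic_6 u * cos (0 * u)"
        using t by (intro tendsto_intros)
      thus "(\<lambda>k. log_cyclotomic_6 u * cos (t k * u)) \<longlonglongrightarrow> log_cyclotomic_6 u" by simp
    qed
    show "AE u in lborel. norm (log_cyclotomic_6 u * cos (t k * u)) \<le> \<bar>log_cyclotomic_6 u\<bar>" for k
      by (rule AE_I2) (simp add: abs_mult mult_left_le)
  qed auto
  hence lim: "(\<lambda>k. \<bar>\<integral>u. log_cyclotomic_6 u * cos (t k * u) \<partial>lborel\<bar>) \<longlonglongrightarrow> \<bar>?I\<bar>"
    by (rule tendsto_rabs)
  have "?I \<noteq> 0"
  proof
    assume "?I = 0"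
    hence "(\<integral>u. - log_cyclotomic_6 u \<partial>lborel) = 0" by simp
    hence "AE u in lborel. - log_cyclotomic_6 u = 0"
      using integrable_log_cyclotomic_6 log_cyclotomic_6_neg
      by (subst (asm) integral_nonneg_eq_0_iff_AE) (auto intro: less_imp_le)
    hence "AE u in (lborel :: real measure). False"
      by (rule AE_mp) (use log_cyclotomic_6_neg in \<open>auto intro!: AE_I2 simp: less_imp_neq\<close>)
    thus False unfolding eventually_False ae_filter_eq_bot_iff by simp
  qed
  hence "\<bar>?I\<bar> / 2 < \<bar>?I\<bar>" "0 < \<bar>?I\<bar> / 2" by simp_all
  with order_tendstoD(1)[OF lim this(1)] show ?thesis
    by (intro that[of "\<bar>?I\<bar> / 2"]) (auto elim: eventually_mono intro: less_imp_le)
qed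

section \<open>Estimates for primorials\<close>

lemma sum_ln_Suc_ge: "real k * ln (real k) - real k \<le> (\<Sum>j<k. ln (real (Suc j)))"
proof (induction k)
  case (Suc k)
  have "real (Suc k) * ln (real (Suc k)) - real (Suc k)
      \<le> real k * ln (real k) - real k + ln (real (Suc k))"
  proof (cases "k = 0")
    case False
    have "ln (real (Suc k) / real k) \<le> real (Suc k) / real k - 1"
      using False by (intro ln_le_minus_one) simp
    hence "real k * (ln (real (Suc k)) - ln (real k)) \<le> real k * (real (Suc k) / real k - 1)"
      using False by (intro mult_left_mono) (simp_all add: ln_div)
    also have "\<dots> = 1" using False by (simp add: field_simps)
    finally show ?thesis by (simp add: algebra_simps)
  qed simp
  thus ?case using Suc by simp
qed simp

text \<open>The upper half of Stirling's ln k! = k ln k - k + O(ln k). The term -k matters: it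
  supplies the 1 in the constant 1 - ln 2 of the comparison between K ln L and L.\<close>

lemma sum_ln_Suc_le:
  assumes "1 \<le> k"
  shows "(\<Sum>j<k. ln (real (Suc j))) \<le> real k * ln (real k) - real k + ln (real k) + 1"
  using assms
proof (induction k rule: nat_induct_at_least)
  case (Suc k)
  have "ln (real k / real (Suc k)) \<le> real k / real (Suc k) - 1"
    using Suc.hyps by (intro ln_le_minus_one) simp
  hence "real (Suc k) * (ln (real k) - ln (real (Suc k))) \<le> real (Suc k) * (real k / real (Suc k) - 1)"
    using Suc.hyps by (intro mult_left_mono) (simp_all add: ln_div)
  also have "\<dots> = - 1" by (simp add: field_simps)
  finally show ?case using Suc.IH by (simp add: algebra_simps)
qed simp

lemma sum_inverse_sqrt_le: "(\<Sum>j<k. 1 / sqrt (real (Suc j))) \<le> 2 * sqrt (real k)"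
proof (induction k)
  case (Suc k)
  let ?a = "sqrt (real k)" and ?b = "sqrt (real (Suc k))"
  have ab: "0 < ?b" "?a \<le> ?b" by simp_all
  have "(?b - ?a) * (?b + ?a) = 1" by (simp add: algebra_simps)
  moreover have "(?b - ?a) * (?b + ?a) \<le> (?b - ?a) * (2 * ?b)"
    using ab by (intro mult_left_mono) auto
  moreover have "(?b - ?a) * (2 * ?b) = (2 * (?b - ?a)) * ?b" by simp
  ultimately have "1 \<le> (2 * (?b - ?a)) * ?b" by argo
  hence "1 / ?b \<le> 2 * (?b - ?a)" using ab(1) by (simp only: pos_divide_le_eq)
  thus ?case using Suc by simp
qed simp

text \<open>Apply \<open>ln y \<le> y\<close> at the fourth root of x. The exponent 1/2 is small
  enough for the sum over x = k / j to stay of order k.\<close>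

lemma ln_squared_le_sqrt:
  fixes x :: real
  assumes "1 \<le> x"
  shows "(ln x)\<^sup>2 \<le> 16 * sqrt x"
proof -
  have "ln x = 4 * ln (sqrt (sqrt x))" using assms by (simp add: ln_sqrt)
  also have "\<dots> \<le> 4 * sqrt (sqrt x)" using assms ln_le_minus_one[of "sqrt (sqrt x)"] by simp
  finally have "(ln x)\<^sup>2 \<le> (4 * sqrt (sqrt x))\<^sup>2" using assms by (intro power_mono) auto
  thus ?thesis using assms by (simp add: power_mult_distrib)
qed

text \<open>A bounded mean square of ln (k / j) expresses that most indices are close to k on the
  logarithmic scale; this controls the total loss in the product of sines.\<close>

lemma sum_ln_squared_le: "(\<Sum>j<k. (ln (real k / real (Suc j)))\<^sup>2) \<le> 32 * real k"
proof -
  have "(\<Sum>j<k. (ln (real k / real (Suc j)))\<^sup>2) \<le> (\<Sum>j<k. 16 * sqrt (real k) * (1 / sqrt (real (Suc j))))"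
  proof (intro sum_mono)
    fix j assume "j \<in> {..<k}"
    hence "1 \<le> real k / real (Suc j)" by (simp add: field_simps)
    from ln_squared_le_sqrt[OF this]
    show "(ln (real k / real (Suc j)))\<^sup>2 \<le> 16 * sqrt (real k) * (1 / sqrt (real (Suc j)))"
      by (simp add: real_sqrt_divide)
  qed
  also have "\<dots> \<le> 16 * sqrt (real k) * (2 * sqrt (real k))"
    unfolding sum_distrib_left[symmetric] by (intro mult_left_mono sum_inverse_sqrt_le) simp
  finally show ?thesis by simp
qed

section \<open>Lower bounds for the sine\<close>

lemma sin_ge_half:
  fixes x :: real
  assumes "0 \<le> x" "x \<le> pi / 3"
  shows "x / 2 \<le> sin x"
proof (cases "x = 0")
  case False
  hence "0 < x" using assms by simp
  then obtain z where z: "0 < z" "z < x" "sin x - sin 0 = (x - 0) * cos z"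
    using MVT2[of 0 x sin cos] by (auto intro: DERIV_sin)
  have "cos (pi / 3) \<le> cos z" using z assms by (intro cos_monotone_0_pi_le) auto
  hence "1 / 2 \<le> cos z" by (simp add: cos_60)
  hence "x * (1 / 2) \<le> x * cos z" using assms by (intro mult_left_mono) auto
  thus ?thesis using z by simp
qed simp

text \<open>The quadratic loss at \<open>w = 0\<close> is what makes the final estimate work; the factor \<open>\<kappa>\<close> absorbs
  the vanishing of the sine at \<open>w = 1\<close>.\<close>

lemma abs_sin_ge_exp:
  fixes w \<kappa> :: real
  assumes w: "- (1 / 2) \<le> w" "w < 1" and \<kappa>: "1 \<le> \<kappa>" "2 * exp (- \<kappa>) \<le> 1 - w"
  shows "exp (- 4 * w\<^sup>2 * \<kappa>) \<le> \<bar>sin (pi / 2 * (1 - w))\<bar>"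
proof (cases "w \<le> 1 / 2")
  case True
  have w2: "w\<^sup>2 \<le> 1 / 4"
    using True w power2_le_iff_abs_le[of "1/2" w] by (simp add: abs_le_iff power2_eq_square)
  \<comment> \<open>Around w = 0 the cosine is at least 1 - 2 w^2, which in turn is at least exp(-4
    w^2) as long as w^2 <= 1/4.\<close>
  have "sin (pi / 2 * (1 - w)) = cos (pi / 2 * w)"
    by (simp only: cos_sin_eq right_diff_distrib mult_1_right of_real_eq_id id_apply)
  also have "\<dots> = 1 - 2 * (sin (pi * w / 4))\<^sup>2"
    using cos_double_sin[of "pi * w / 4"] by (simp add: algebra_simps)
  finally have sin_eq: "sin (pi / 2 * (1 - w)) = 1 - 2 * (sin (pi * w / 4))\<^sup>2" .
  have "(sin (pi * w / 4))\<^sup>2 \<le> (pi * w / 4)\<^sup>2"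
    using abs_sin_x_le_abs_x[of "pi * w / 4"] by (simp only: abs_le_square_iff)
  also have "\<dots> \<le> w\<^sup>2"
  proof -
    have "\<bar>pi * w / 4\<bar> \<le> \<bar>w\<bar>" using pi_less_4 mult_right_mono[of pi 4 "\<bar>w\<bar>"] by (simp add: abs_mult)
    thus ?thesis by (simp only: abs_le_square_iff)
  qed
  finally have sin_ge: "1 - 2 * w\<^sup>2 \<le> sin (pi / 2 * (1 - w))" unfolding sin_eq by simp
  have "ln (1 / (1 - 2 * w\<^sup>2)) \<le> 1 / (1 - 2 * w\<^sup>2) - 1"
    using w2 by (intro ln_le_minus_one) simp
  also have "\<dots> = 2 * w\<^sup>2 / (1 - 2 * w\<^sup>2)" using w2 by (simp add: field_simps)
  also have "\<dots> \<le> 2 * w\<^sup>2 / (1 / 2)" using w2 by (intro divide_left_mono) auto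
  also have "\<dots> \<le> 4 * w\<^sup>2 * \<kappa>" using \<kappa>(1) mult_left_mono[of 1 \<kappa> "4 * w\<^sup>2"] by simp
  finally have "- 4 * w\<^sup>2 * \<kappa> \<le> ln (1 - 2 * w\<^sup>2)" using w2 by (simp add: ln_div)
  hence "exp (- 4 * w\<^sup>2 * \<kappa>) \<le> 1 - 2 * w\<^sup>2" using w2 by (subst (asm) ln_ge_iff) auto
  thus ?thesis using sin_ge by linarith
next
  case False
  \<comment> \<open>Now 4 w^2 >= 1, so the left side is at most exp(-\<kappa>), which the hypothesis
    compares with 1 - w. The argument of the sine is below pi/4, within reach of
    \<open>sin_ge_half\<close>.\<close>
  hence "1 / 4 \<le> w\<^sup>2" using power_mono[of "1/2" w 2] by (simp add: power2_eq_square)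
  hence "\<kappa> * (1 / 4) \<le> \<kappa> * w\<^sup>2" using \<kappa>(1) by (intro mult_left_mono) auto
  hence "exp (- 4 * w\<^sup>2 * \<kappa>) \<le> exp (- \<kappa>)" by (simp add: mult_ac)
  also have "\<dots> \<le> (1 - w) / 2" using \<kappa>(2) by simp
  also have "\<dots> \<le> (pi / 2 * (1 - w)) / 2"
    using w pi_gt3 mult_right_mono[of 1 "pi / 2" "1 - w"] by simp
  also have "\<dots> \<le> sin (pi / 2 * (1 - w))"
    using False w pi_gt_zero by (intro sin_ge_half) (simp_all add: field_simps)
  finally show ?thesis by linarith
qed

section \<open>Primorials and the size of their logarithms\<close>

definition primorial :: "nat \<Rightarrow> nat" where
  "primorial k = (\<Prod>j<k. nth_prime j)"

lemma nth_prime_gt_1: "1 < nth_prime j"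
  by (rule prime_gt_1_nat[OF prime_nth_prime])

lemma primorial_pos: "0 < primorial k"
  unfolding primorial_def using nth_prime_gt_1 by (intro prod_pos) (auto intro: less_trans[of _ 1])

lemma ln_primorial: "ln (real (primorial k)) = (\<Sum>j<k. ln (real (nth_prime j)))"
  unfolding primorial_def of_nat_prod using nth_prime_gt_1 
  by (intro ln_prod) (auto intro: less_trans[of _ 1])

lemma strict_mono_primorial: "strict_mono primorial"
  unfolding strict_mono_Suc_iff using primorial_pos nth_prime_gt_1 by (simp add: primorial_def)

lemma not_nth_prime_dvd_primorial: "\<not> nth_prime k dvd primorial k"
proof
  assume "nth_prime k dvd primorial k"
  then obtain j where "j < k" "nth_prime k dvd nth_prime j"
    unfolding primorial_def by (auto simp: prime_dvd_prod_iff prime_nth_prime)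
  hence "nth_prime k = nth_prime j" using primes_dvd_imp_eq prime_nth_prime by blast
  thus False using \<open>j < k\<close> nth_prime_less_iff[of j k] by simp
qed

text \<open>The crude bound ln p <= 2 ln (2k), inserted once into ln p <= ln (2k) + ln ln p. Being
  explicit in x, it leaves only limits of elementary functions to check.\<close>

definition prime_log_bound :: "real \<Rightarrow> real" where
  "prime_log_bound x = ln 2 + ln x + ln (2 * ln 2 + 2 * ln x)"

lemma ln_nth_prime_bound:
  assumes "2 \<le> k"
  shows "ln (real (nth_prime (k - 1))) \<le> prime_log_bound (real k)"
proof -
  define \<Lambda> where "\<Lambda> = ln (real (nth_prime (k - 1)))"
  have \<Lambda>: "0 < \<Lambda>" unfolding \<Lambda>_def using nth_prime_gt_1[of "k - 1"] by simp
  have "real (nth_prime (k - 1)) \<le> 2 * real k * \<Lambda>"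
    using nth_prime_le_ln[of "k - 1"] assms by (simp add: \<Lambda>_def)
  hence "\<Lambda> \<le> ln (2 * real k * \<Lambda>)"
    unfolding \<Lambda>_def using nth_prime_gt_1[of "k - 1"] assms by (subst ln_le_cancel_iff) auto
  hence le: "\<Lambda> \<le> ln 2 + ln (real k) + ln \<Lambda>" using assms \<Lambda> by (simp add: ln_mult)
  \<comment> \<open>Bounding ln \<Lambda> by \<Lambda> / 2 breaks the self-reference and gives the
    crude bound on \<Lambda>.\<close>
  have "ln (\<Lambda> / 2) \<le> \<Lambda> / 2 - 1" using \<Lambda> by (intro ln_le_minus_one) simp
  hence "ln \<Lambda> \<le> \<Lambda> / 2" using \<Lambda> ln_2_less_1 by (simp add: ln_div)
  hence "\<Lambda> \<le> 2 * ln 2 + 2 * ln (real k)" using le by simp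
  hence "ln \<Lambda> \<le> ln (2 * ln 2 + 2 * ln (real k))" using \<Lambda> by (subst ln_le_cancel_iff) auto
  hence "\<Lambda> \<le> ln 2 + ln (real k) + ln (2 * ln 2 + 2 * ln (real k))" using le by simp
  thus ?thesis unfolding \<Lambda>_def prime_log_bound_def .
qed

text \<open>Lower bounds on L use only p_j >= j + 1 and Stirling, upper bounds the Chebyshev
  estimate. In the third claim 1 comes from Stirling and ln 2 from the factor 2 in p_j <= 2 (j + 1)
  ln p. The last two locate ln p_j relative to ln L from either side.\<close>

lemma primorial_estimates:
  assumes k: "2 \<le> k" and large: "2 \<le> ln (real k)"
  defines "L \<equiv> ln (real (primorial k))" and "x \<equiv> real k" and "\<rho> \<equiv> prime_log_bound (real k)"
  shows "x * (ln x - 1) \<le> L" "L \<le> x * \<rho>"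
    "x * (1 - ln 2 + ln (ln x - 1) - ln \<rho>) - ln x - 1 \<le> x * ln L - L"
    "j < k \<Longrightarrow> ln L - ln (real (nth_prime j)) \<le> ln \<rho> + ln (x / real (Suc j))"
    "j < k \<Longrightarrow> ln ((ln x - 1) / (2 * \<rho>)) \<le> ln L - ln (real (nth_prime j))"
proof -
  define \<Lambda> where "\<Lambda> = ln (real (nth_prime (k - 1)))"
  have x: "0 < x" using k by (simp add: x_def)
  have \<Lambda>: "0 < \<Lambda>" unfolding \<Lambda>_def using nth_prime_gt_1[of "k - 1"] by simp
  have \<Lambda>_le: "\<Lambda> \<le> \<rho>" unfolding \<Lambda>_def \<rho>_def by (rule ln_nth_prime_bound[OF k])
  have \<rho>: "0 < \<rho>" using \<Lambda> \<Lambda>_le by linarith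
  have L_eq: "L = (\<Sum>j<k. ln (real (nth_prime j)))" unfolding L_def by (rule ln_primorial)
  have "x * ln x - x \<le> (\<Sum>j<k. ln (real (Suc j)))" unfolding x_def by (rule sum_ln_Suc_ge)
  also have "\<dots> \<le> L" unfolding L_eq
  proof (intro sum_mono)
    fix j show "ln (real (Suc j)) \<le> ln (real (nth_prime j))"
      using nth_prime_ge[of j] by (subst ln_le_cancel_iff) auto
  qed
  finally show lower: "x * (ln x - 1) \<le> L" by (simp add: algebra_simps)
  have "L \<le> (\<Sum>j<k. \<Lambda>)" unfolding L_eq
  proof (intro sum_mono)
    fix j assume "j \<in> {..<k}"
    hence "nth_prime j \<le> nth_prime (k - 1)" by simp
    thus "ln (real (nth_prime j)) \<le> \<Lambda>" unfolding \<Lambda>_def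
      using nth_prime_gt_1[of j] nth_prime_gt_1[of "k - 1"]
      by (subst ln_le_cancel_iff) (auto simp del: nth_prime_le_iff)
  qed
  hence L_le: "L \<le> x * \<Lambda>" by (simp add: x_def)
  also have "\<dots> \<le> x * \<rho>" using \<Lambda>_le x by (intro mult_left_mono) auto
  finally show "L \<le> x * \<rho>" .
  have ln_p: "ln (real (nth_prime j)) \<le> ln 2 + ln (real (Suc j)) + ln \<Lambda>" if "j < k" for j
  proof -
    have "real (nth_prime j) \<le> 2 * real (Suc j) * \<Lambda>"
      unfolding \<Lambda>_def using that k by (intro nth_prime_le) auto
    hence "ln (real (nth_prime j)) \<le> ln (2 * real (Suc j) * \<Lambda>)"
      using nth_prime_gt_1[of j] \<Lambda> by (subst ln_le_cancel_iff) auto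
    thus ?thesis using \<Lambda> by (simp add: ln_mult del: of_nat_Suc)
  qed
  have ln\<Lambda>: "ln \<Lambda> \<le> ln \<rho>" using \<Lambda> \<Lambda>_le by (intro ln_mono) auto
  have ln_L_lower: "ln x + ln (ln x - 1) \<le> ln L"
  proof -
    have "ln x + ln (ln x - 1) = ln (x * (ln x - 1))"
      using x large by (simp add: ln_mult x_def)
    also have "\<dots> \<le> ln L" using x large lower by (intro ln_mono) (auto simp: x_def)
    finally show ?thesis .
  qed
  have "L \<le> (\<Sum>j<k. ln 2 + ln (real (Suc j)) + ln \<rho>)"
    unfolding L_eq using ln_p ln\<Lambda> by (intro sum_mono) force
  also have "\<dots> = x * (ln 2 + ln \<rho>) + (\<Sum>j<k. ln (real (Suc j)))"
    by (simp add: sum.distrib x_def algebra_simps)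
  also have "(\<Sum>j<k. ln (real (Suc j))) \<le> x * ln x - x + ln x + 1"
    unfolding x_def using k by (intro sum_ln_Suc_le) simp
  finally have "L \<le> x * (ln 2 + ln \<rho> + ln x - 1) + ln x + 1" by (simp add: algebra_simps)
  moreover have "x * (ln x + ln (ln x - 1)) \<le> x * ln L"
    using ln_L_lower x by (intro mult_left_mono) auto
  ultimately show "x * (1 - ln 2 + ln (ln x - 1) - ln \<rho>) - ln x - 1 \<le> x * ln L - L"
    by (simp add: algebra_simps)
  show "ln L - ln (real (nth_prime j)) \<le> ln \<rho> + ln (x / real (Suc j))" if "j < k"
  proof -
    have "0 < x * (ln x - 1)" using x large by (simp add: x_def)
    hence "ln L \<le> ln (x * \<Lambda>)" using L_le lower by (intro ln_mono) auto
    also have "\<dots> = ln x + ln \<Lambda>" using x \<Lambda> by (simp add: ln_mult)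
    finally have "ln L \<le> ln x + ln \<rho>" using ln\<Lambda> by simp
    moreover have "ln (real (Suc j)) \<le> ln (real (nth_prime j))"
      using nth_prime_ge[of j] by (subst ln_le_cancel_iff) auto
    ultimately show ?thesis using x by (simp add: ln_div del: of_nat_Suc)
  qed
  show "ln ((ln x - 1) / (2 * \<rho>)) \<le> ln L - ln (real (nth_prime j))" if "j < k"
  proof -
    have "ln (real (Suc j)) \<le> ln x" using that by (simp add: x_def)
    hence "ln (real (nth_prime j)) \<le> ln 2 + ln x + ln \<rho>" using ln_p[OF that] ln\<Lambda> by linarith
    moreover have "ln ((ln x - 1) / (2 * \<rho>)) = ln (ln x - 1) - ln 2 - ln \<rho>"
      using large \<rho> by (simp add: ln_div ln_mult x_def)
    ultimately show ?thesis using ln_L_lower by linarith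
  qed
qed

section \<open>Asymptotic inequalities in the number of primes\<close>

lemma eventually_deficit_bound:
  "eventually (\<lambda>x. 1 / 4 \<le> 1 - ln 2 + ln (ln x - 1) - ln (prime_log_bound x) - (ln x + 1) / x) at_top"
proof -
  \<comment> \<open>The two iterated logarithms cancel in the limit, since both of their arguments
    are asymptotic to ln x.\<close>
  have "((\<lambda>x. 1 - ln 2 + ln (ln x - 1) - ln (prime_log_bound x) - (ln x + 1) / x) \<longlongrightarrow> 1 - ln 2) at_top"
    unfolding prime_log_bound_def by real_asymp
  moreover have "1 / 4 < 1 - ln (2 :: real)" using ln2_le_25_over_36 by simp
  ultimately have "eventually (\<lambda>x. 1 / 4 < 1 - ln 2 + ln (ln x - 1) - ln (prime_log_bound x) - (ln x + 1) / x) at_top"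
    by (rule order_tendstoD(1))
  thus ?thesis by eventually_elim simp
qed

lemma eventually_ln_prime_log_bound_le: "eventually (\<lambda>x. ln x + ln (prime_log_bound x) \<le> 2 * ln x) at_top"
  unfolding prime_log_bound_def by real_asymp

text \<open>The ratio tends to 1/2; the weaker 1/8 is where the later constant ln 8 comes
  from.\<close>

lemma eventually_prime_log_bound_ratio: "eventually (\<lambda>x. 1 / 8 \<le> (ln x - 1) / (2 * prime_log_bound x)) at_top"
  unfolding prime_log_bound_def by real_asymp

lemma eventually_prime_log_bound_ge_1: "eventually (\<lambda>x. 1 \<le> prime_log_bound x) at_top"
  unfolding prime_log_bound_def by real_asymp

text \<open>The first term on the right is the gain from the excess of K over L / ln L; the
  subtracted term, of order x (ln ln x)^3 / (ln x)^2, is the loss in the sines. The surplus 2 ln x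
  becomes a spare factor x^2.\<close>

lemma eventually_exponent_ge:
  "eventually (\<lambda>x. 2 * ln x \<le> x / (12 * ln x)
     - 4 * ln (8 * ln x) * ((2 * (ln 8 + ln (prime_log_bound x))\<^sup>2 + 64) * x / (ln x)\<^sup>2)) at_top"
  unfolding prime_log_bound_def by real_asymp

lemma eventually_prime_log_bound_less:
  assumes "0 < (c::real)"
  shows "eventually (\<lambda>x. 16 * (x * prime_log_bound x) + 4 * J < c / 4 * x\<^sup>2) at_top"
proof -
  have "((\<lambda>x. (16 * (x * prime_log_bound x) + 4 * J) / x\<^sup>2) \<longlongrightarrow> 0) at_top"
    unfolding prime_log_bound_def by real_asymp
  moreover have "0 < c / 4" using assms by simp
  ultimately have "eventually (\<lambda>x. (16 * (x * prime_log_bound x) + 4 * J) / x\<^sup>2 < c / 4) at_top"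
    by (rule order_tendstoD(2))
  thus ?thesis using eventually_gt_at_top[of 0]
    by eventually_elim (simp add: pos_divide_less_eq)
qed

section \<open>Large values of cyclotomic polynomials\<close>

text \<open>The primes 2 and 3 are already contained in 6, so k differences belong to the product of
  the first k + 2 primes.\<close>

abbreviation log_cyclotomic_primorial :: "nat \<Rightarrow> real \<Rightarrow> real" where
  "log_cyclotomic_primorial \<equiv>
     iterated_difference log_cyclotomic_6 (\<lambda>j. ln (real (nth_prime (j + 2))))"

lemma cyclotomic_primorial:
  "cyclotomic (primorial (k + 2)) (of_real (exp (- exp u))) = of_real (exp (log_cyclotomic_primorial k u))"
proof (induction k arbitrary: u)
  case 0
  define z where "z = exp (- exp u)"
  have z: "0 < z" "z < 1" by (simp_all add: z_def)
  hence "z ^ 3 < 1" using power_strict_mono[of z 1 3] by simp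
  hence "of_real z \<noteq> (1 :: complex)" "(of_real z) ^ 3 \<noteq> (1 :: complex)" "of_real z \<noteq> (- 1 :: complex)"
    using z by (auto simp: complex_eq_iff simp flip: of_real_power)
  hence "cyclotomic 6 (of_real z) = of_real (1 - z + z ^ 2)"
    by (subst cyclotomic_6) auto
  moreover have "0 < 1 - z + z ^ 2" using z zero_less_power[of z 2] by linarith
  moreover have "primorial (0 + 2) = 6"
    by (simp add: primorial_def numeral_2_eq_2 nth_prime_0 nth_prime_1)
  ultimately show ?case by (simp add: log_cyclotomic_6_def z_def)
next
  case (Suc k)
  let ?p = "nth_prime (k + 2)" and ?G = "log_cyclotomic_primorial k"
  let ?z = "of_real (exp (- exp u)) :: complex"
  have p: "0 < ?p" by (rule prime_gt_0_nat[OF prime_nth_prime])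
  have "?z ^ ?p = of_real (exp (- exp u) ^ ?p)" by simp
  also have "exp (- exp u) ^ ?p = exp (- exp (u + ln (real ?p)))"
    using p by (simp add: exp_add mult.commute flip: exp_of_nat_mult)
  finally have "cyclotomic (primorial (k + 2) * ?p) ?z * cyclotomic (primorial (k + 2)) ?z =
      of_real (exp (?G (u + ln (real ?p))))"
    using cyclotomic_mult_prime[OF prime_nth_prime not_nth_prime_dvd_primorial primorial_pos, of "k + 2" ?z]
    by (simp only: Suc)
  hence "cyclotomic (primorial (k + 2) * ?p) ?z = of_real (exp (?G (u + ln (real ?p))) / exp (?G u))"
    unfolding Suc by (simp add: field_simps)
  also have "\<dots> = of_real (exp (log_cyclotomic_primorial (Suc k) u))"
    by (simp add: exp_diff)
  also have "primorial (k + 2) * ?p = primorial (Suc k + 2)" by (simp add: primorial_def)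
  finally show ?case .
qed

lemma sum_lessThan_add_2: "(\<Sum>j<k + 2. f j) = f 0 + f 1 + (\<Sum>j<k. f (j + 2))"
  for f :: "nat \<Rightarrow> real"
  by (induction k) (simp_all add: numeral_2_eq_2)

text \<open>If G stayed at or below T = 2^(L / ln L), the Fourier inequality, with c > 0 bounding
  the transform of G_6 from below, would give c T x^2 / 4 <= (16 x \<rho> + 4 J) T. This fails for a
  large number x of primes, as \<rho> is of order ln x.\<close>

lemma eventually_log_cyclotomic_primorial_large:
  "eventually (\<lambda>k. \<exists>u. exp (ln 2 * ln (real (primorial (k + 2))) / ln (ln (real (primorial (k + 2)))))
     < log_cyclotomic_primorial k u) sequentially"
proof -
  define t where "t k = pi / ln (ln (real (primorial (k + 2))))" for k
  have "strict_mono (\<lambda>k. primorial (k + 2))"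
    using strict_mono_primorial by (simp add: strict_mono_def)
  hence "filterlim (\<lambda>k. real (primorial (k + 2))) at_top sequentially"
    by (intro filterlim_compose[OF filterlim_real_sequentially] filterlim_subseq)
  moreover have "((\<lambda>x. pi / ln (ln x)) \<longlongrightarrow> 0) at_top" by real_asymp
  ultimately have "t \<longlonglongrightarrow> 0" unfolding t_def by (rule filterlim_compose[rotated])
  then obtain c where c: "0 < c"
    and ev_c: "eventually (\<lambda>k. c \<le> \<bar>\<integral>u. log_cyclotomic_6 u * cos (t k * u) \<partial>lborel\<bar>) sequentially"
    by (rule log_cyclotomic_6_cos_integral_away_from_0)
  define J :: real where "J = (\<integral>u. exp (- \<bar>u\<bar> / 2) \<partial>lborel)"
  have J: "0 \<le> J" unfolding J_def by (rule Bochner_Integration.integral_nonneg) simp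
  have lim: "filterlim (\<lambda>k. real (k + 2)) at_top sequentially" by real_asymp
  have ln_large: "eventually (\<lambda>x::real. 2 * ln 8 \<le> ln x) at_top" by real_asymp
  note evs = eventually_deficit_bound eventually_ln_prime_log_bound_le eventually_prime_log_bound_ratio
    eventually_prime_log_bound_ge_1 eventually_exponent_ge eventually_prime_log_bound_less[OF c, of J] ln_large
  note evs' = evs[THEN eventually_compose_filterlim, OF lim]
  show ?thesis using evs' ev_c eventually_gt_at_top[of 0]
  proof eventually_elim
    case (elim k)
    define K where "K = k + 2"
    define x where "x = real K"
    define \<rho> where "\<rho> = prime_log_bound x"
    define L where "L = ln (real (primorial K))"
    \<comment> \<open>Chosen so that 2 exp(-\<kappa>) = 1 / (4 ln x), which is at most 1 - w_j = ln
      p_j / ln L, because ln L <= 2 ln x and ln p_j >= 1/2.\<close>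
    define \<kappa> where "\<kappa> = ln (8 * ln x)"
    \<comment> \<open>The relative distance of ln p_j from ln L, normalized so that t ln p_j / 2 =
      pi / 2 * (1 - w_j).\<close>
    define w where "w j = 1 - ln (real (nth_prime j)) / ln L" for j
    define W where "W = (\<Sum>j<K. (w j)\<^sup>2)"
    define T where "T = exp (ln 2 * L / ln L)"
    define a where "a j = ln (real (nth_prime (j + 2)))" for j
    note elim' = elim[folded K_def, folded x_def, folded \<rho>_def]
    have K2: "2 \<le> K" by (simp add: K_def)
    have x: "0 < x" "1 < x" by (simp_all add: x_def K_def)
    have ln8: "1 \<le> ln (8::real)" using exp_le by (subst ln_ge_iff) auto
    hence lnx: "2 \<le> ln x" using elim'(7) by linarith
    note est = primorial_estimates[OF K2, folded x_def, folded L_def \<rho>_def, OF lnx]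
    have \<rho>: "1 \<le> \<rho>" "0 \<le> ln \<rho>" using elim'(4) by auto
    have "x * 1 \<le> x * (ln x - 1)" using lnx x by (intro mult_left_mono) auto
    hence xL: "x \<le> L" using est(1) by simp
    have lnL: "ln x \<le> ln L" using xL x by (intro ln_mono) auto
    have lnL2: "ln L \<le> 2 * ln x"
    proof -
      have "ln L \<le> ln (x * \<rho>)" using est(2) xL x by (intro ln_mono) auto
      also have "\<dots> = ln x + ln \<rho>" using x \<rho> by (simp add: ln_mult)
      finally show ?thesis using elim'(2) by linarith
    qed
    have lnL_pos: "0 < ln L" using lnL lnx by linarith
    have T1: "1 \<le> T" unfolding T_def using xL x lnL_pos by simp
    have deficit: "x / 4 \<le> x * ln L - L"
    proof -
      have "x * (1 / 4) \<le> x * (1 - ln 2 + ln (ln x - 1) - ln \<rho> - (ln x + 1) / x)"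
        using elim'(1) x by (intro mult_left_mono) auto
      also have "\<dots> = x * (1 - ln 2 + ln (ln x - 1) - ln \<rho>) - ln x - 1"
        using x by (simp add: field_simps)
      finally show ?thesis using est(3) by simp
    qed
    have w_eq: "w j = (ln L - ln (real (nth_prime j))) / ln L" for j
      unfolding w_def using lnL_pos by (simp add: field_simps)
    have diff_ge: "- ln 8 \<le> ln L - ln (real (nth_prime j))" if "j < K" for j
    proof -
      have "- ln 8 = ln (1 / 8 :: real)" by (simp add: ln_div)
      also have "\<dots> \<le> ln ((ln x - 1) / (2 * \<rho>))" using elim'(3) by (intro ln_mono) auto
      finally show ?thesis using est(5)[OF that] by linarith
    qed
    have w_ge: "- (1 / 2) \<le> w j" if "j < K" for j
    proof -
      have "- (1 / 2) * ln L \<le> ln L - ln (real (nth_prime j))"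
        using diff_ge[OF that] elim'(7) lnL by linarith
      thus ?thesis unfolding w_eq using lnL_pos by (simp only: pos_le_divide_eq)
    qed
    have w_less: "w j < 1" for j
      unfolding w_def using nth_prime_gt_1[of j] lnL_pos by simp
    have \<kappa>1: "1 \<le> \<kappa>"
    proof -
      have "ln 8 \<le> \<kappa>" unfolding \<kappa>_def using lnx by (intro ln_mono) auto
      thus ?thesis using ln8 by linarith
    qed
    have \<kappa>_le: "2 * exp (- \<kappa>) \<le> 1 - w j" for j
    proof -
      have "2 * exp (- \<kappa>) = 1 / 2 / (2 * ln x)"
        unfolding \<kappa>_def using lnx by (simp add: exp_minus field_simps)
      also have "\<dots> \<le> 1 / 2 / ln L"
        using lnL2 lnL_pos by (intro divide_left_mono) auto
      also have "\<dots> \<le> ln (real (nth_prime j)) / ln L"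
      proof (intro divide_right_mono)
        have "ln 2 \<le> ln (real (nth_prime j))" using nth_prime_gt_1[of j] by (intro ln_mono) auto
        thus "1 / 2 \<le> ln (real (nth_prime j))" using ln2_ge_two_thirds by linarith
      qed (use lnL_pos in simp)
      finally show ?thesis by (simp add: w_def)
    qed
    have W_le: "W \<le> (2 * (ln 8 + ln \<rho>)\<^sup>2 + 64) * x / (ln x)\<^sup>2"
    proof -
      have "(w j)\<^sup>2 \<le> (2 * (ln 8 + ln \<rho>)\<^sup>2 + 2 * (ln (x / real (Suc j)))\<^sup>2) / (ln x)\<^sup>2" if j: "j < K" for j
      proof -
        let ?A = "ln 8 + ln \<rho>" and ?B = "ln (x / real (Suc j))"
        have "1 \<le> x / real (Suc j)" using j by (simp add: x_def field_simps)
        hence B: "0 \<le> ?B" by (rule ln_ge_zero)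
        \<comment> \<open>The summand ln 8 in \<open>?A\<close> covers the primes above L, for which
          the difference is negative.\<close>
        have "\<bar>ln L - ln (real (nth_prime j))\<bar> \<le> \<bar>?A + ?B\<bar>"
          using est(4)[OF j] diff_ge[OF j] \<rho>(2) B ln8 by linarith
        hence "(ln L - ln (real (nth_prime j)))\<^sup>2 \<le> (?A + ?B)\<^sup>2" by (simp only: abs_le_square_iff)
        also have "\<dots> \<le> 2 * ?A\<^sup>2 + 2 * ?B\<^sup>2"
          using zero_le_power2[of "?A - ?B"] by (simp add: power2_eq_square algebra_simps)
        finally have "(ln L - ln (real (nth_prime j)))\<^sup>2 \<le> 2 * ?A\<^sup>2 + 2 * ?B\<^sup>2" .
        moreover have "(ln x)\<^sup>2 \<le> (ln L)\<^sup>2" using lnL lnx by (intro power_mono) auto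
        ultimately show ?thesis
          unfolding w_eq power_divide using lnx by (intro frac_le) auto
      qed
      hence "W \<le> (\<Sum>j<K. (2 * (ln 8 + ln \<rho>)\<^sup>2 + 2 * (ln (x / real (Suc j)))\<^sup>2) / (ln x)\<^sup>2)"
        unfolding W_def by (intro sum_mono) auto
      also have "\<dots> = (2 * (x * (ln 8 + ln \<rho>)\<^sup>2) + 2 * (\<Sum>j<K. (ln (x / real (Suc j)))\<^sup>2)) / (ln x)\<^sup>2"
        by (simp only: sum_divide_distrib[symmetric] sum.distrib sum_distrib_left[symmetric]
            sum_constant card_lessThan x_def)
      also have "\<dots> \<le> (2 * (x * (ln 8 + ln \<rho>)\<^sup>2) + 2 * (32 * x)) / (ln x)\<^sup>2"
        using sum_ln_squared_le[of K] by (intro divide_right_mono add_left_mono mult_left_mono) (auto simp: x_def)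
      finally show ?thesis by (simp add: algebra_simps)
    qed
    have prod_ge: "T * x\<^sup>2 / 4 \<le> (\<Prod>j<k. 2 * \<bar>sin (t k * a j / 2)\<bar>)"
    proof -
      \<comment> \<open>Here 1/12 is 2/3 (for ln 2) times 1/4 (the deficit) times 1/2 (from ln L <=
        2 ln x).\<close>
      have ratio: "x / (12 * ln x) \<le> ln 2 * (x * ln L - L) / ln L"
      proof -
        have "x / (12 * ln x) = 2 / 3 * (x / 4) / (2 * ln x)" by simp
        also have "\<dots> \<le> 2 / 3 * (x / 4) / ln L"
          using lnL2 lnL_pos lnx x by (intro divide_left_mono mult_pos_pos) auto
        also have "\<dots> \<le> ln 2 * (x * ln L - L) / ln L"
          using deficit ln2_ge_two_thirds lnL_pos x by (intro divide_right_mono mult_mono) auto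
        finally show ?thesis .
      qed
      have "4 * \<kappa> * W \<le> 4 * \<kappa> * ((2 * (ln 8 + ln \<rho>)\<^sup>2 + 64) * x / (ln x)\<^sup>2)"
        using W_le \<kappa>1 by (intro mult_left_mono) auto
      with elim'(5) ratio have "2 * ln x \<le> ln 2 * (x * ln L - L) / ln L - 4 * \<kappa> * W"
        unfolding \<kappa>_def by linarith
      moreover have "ln 2 * x = ln 2 * L / ln L + ln 2 * (x * ln L - L) / ln L"
        using lnL_pos by (simp add: field_simps)
      ultimately have "ln 2 * L / ln L + 2 * ln x \<le> ln 2 * x - 4 * \<kappa> * W" by linarith
      hence "exp (ln 2 * L / ln L + 2 * ln x) \<le> exp (ln 2 * x - 4 * \<kappa> * W)" by simp
      moreover have "exp (ln 2 * L / ln L + 2 * ln x) = T * x\<^sup>2"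
        using x by (simp add: T_def exp_add exp_double)
      \<comment> \<open>The factor 4 belongs to the primes 2 and 3, which contribute no sine; it is
        the origin of the denominator 4 in \<open>prod_ge\<close>.\<close>
      moreover have "exp (ln 2 * x - 4 * \<kappa> * W) = 2 ^ k * 4 * exp (- (4 * \<kappa> * W))"
      proof -
        have "exp (ln 2 * x) = exp (ln 2) ^ K"
          unfolding x_def by (rule exp_of_nat2_mult)
        thus ?thesis by (simp add: exp_diff exp_minus K_def field_simps)
      qed
      ultimately have "T * x\<^sup>2 / 4 \<le> 2 ^ k * exp (- (4 * \<kappa> * W))" by simp
      also have "\<dots> \<le> 2 ^ k * exp (- (4 * \<kappa> * (\<Sum>j<k. (w (j + 2))\<^sup>2)))"
      proof -
        have "(\<Sum>j<k. (w (j + 2))\<^sup>2) \<le> W"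
          unfolding W_def K_def sum_lessThan_add_2 by simp
        hence "4 * \<kappa> * (\<Sum>j<k. (w (j + 2))\<^sup>2) \<le> 4 * \<kappa> * W"
          using \<kappa>1 by (intro mult_left_mono) auto
        thus ?thesis by simp
      qed
      also have "\<dots> = (\<Prod>j<k. 2 * exp (- 4 * (w (j + 2))\<^sup>2 * \<kappa>))"
        by (simp add: prod.distrib sum_distrib_left sum_negf[symmetric] exp_sum mult_ac)
      also have "\<dots> \<le> (\<Prod>j<k. 2 * \<bar>sin (t k * a j / 2)\<bar>)"
      proof (intro prod_mono conjI mult_left_mono)
        fix j assume "j \<in> {..<k}"
        hence j: "j + 2 < K" by (simp add: K_def)
        have "t k * a j / 2 = pi / 2 * (1 - w (j + 2))"
          by (simp add: t_def a_def w_def L_def K_def)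
        thus "exp (- 4 * (w (j + 2))\<^sup>2 * \<kappa>) \<le> \<bar>sin (t k * a j / 2)\<bar>"
          using abs_sin_ge_exp[OF w_ge[OF j] w_less \<kappa>1 \<kappa>_le] by simp
      qed auto
      finally show ?thesis .
    qed
    have a_nonneg: "0 \<le> a j" for j
      unfolding a_def using nth_prime_gt_1[of "j + 2"] by (intro ln_ge_zero) simp
    have exp_prod: "(\<Prod>j<k. exp (a j) + 1) \<le> exp (2 * L)"
    proof -
      have a_ge: "2 \<le> exp (a j)" for j
        using nth_prime_gt_1[of "j + 2"] by (simp add: a_def)
      have "(\<Prod>j<k. exp (a j) + 1) \<le> (\<Prod>j<k. exp (2 * a j))"
      proof (intro prod_mono conjI)
        fix j
        have "exp (a j) + 1 \<le> 2 * exp (a j)" using a_ge[of j] by linarith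
        also have "\<dots> \<le> exp (a j) * exp (a j)" using a_ge[of j] by (intro mult_right_mono) auto
        finally show "exp (a j) + 1 \<le> exp (2 * a j)" by (simp flip: exp_add)
      qed (simp add: add_nonneg_nonneg)
      also have "\<dots> = exp (2 * (\<Sum>j<k. a j))" by (simp add: exp_sum sum_distrib_left)
      also have "(\<Sum>j<k. a j) \<le> L"
        unfolding L_def ln_primorial K_def a_def sum_lessThan_add_2
        using nth_prime_gt_1[of 0] nth_prime_gt_1[of 1] by simp
      finally show ?thesis by simp
    qed
    have "\<exists>u. T < log_cyclotomic_primorial k u"
    proof (rule ccontr)
      assume "\<nexists>u. T < log_cyclotomic_primorial k u"
      hence ub: "iterated_difference log_cyclotomic_6 a k u \<le> T" for u
        unfolding a_def by (simp add: not_less)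
      have "T * x\<^sup>2 / 4 * c \<le>
          (\<Prod>j<k. 2 * \<bar>sin (t k * a j / 2)\<bar>) * \<bar>\<integral>u. log_cyclotomic_6 u * cos (t k * u) \<partial>lborel\<bar>"
        using prod_ge elim'(8) c T1 by (intro mult_mono prod_nonneg) auto
      \<comment> \<open>The cutoff is U = 4 L, so that exp(-U/2) = exp(-2 L) cancels the growth
        \<open>exp (2 * L)\<close> of the decay constant.\<close>
      also have "\<dots> \<le> 4 * (4 * L) * T + 2 * (2 * (\<Prod>j<k. exp (a j) + 1)) * exp (- (4 * L) / 2) * J"
        unfolding J_def
        using a_nonneg elim'(9) T1 xL x ub
        by (intro iterated_difference_upper_bound_imp integrable_log_cyclotomic_6 log_cyclotomic_6_bound) auto
      also have "2 * (2 * (\<Prod>j<k. exp (a j) + 1)) * exp (- (4 * L) / 2) * J \<le>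
          2 * (2 * exp (2 * L)) * exp (- (4 * L) / 2) * J"
        using exp_prod J by (intro mult_right_mono mult_left_mono) auto
      also have "\<dots> = 4 * J" by (simp add: exp_minus)
      also have "4 * (4 * L) * T + 4 * J \<le> 16 * (x * \<rho>) * T + 4 * J * T"
      proof (rule add_mono)
        show "4 * (4 * L) * T \<le> 16 * (x * \<rho>) * T" using est(2) T1 by (intro mult_right_mono) auto
        show "4 * J \<le> 4 * J * T" using mult_left_mono[OF T1 J] by simp
      qed
      also have "\<dots> = (16 * (x * \<rho>) + 4 * J) * T" by (simp add: algebra_simps)
      also have "\<dots> < c / 4 * x\<^sup>2 * T" using elim'(6) T1 by (intro mult_strict_right_mono) auto
      finally show False by (simp add: mult_ac)
    qed
    thus ?case by (simp add: T_def L_def K_def)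
  qed
qed

theorem theorem1p1:
  fixes \<zeta> :: "nat \<Rightarrow> nat \<Rightarrow> complex"
  assumes "\<And>n. 0 < n \<Longrightarrow> bij_betw (\<zeta> n) {..<totient n} (primitive_unity_roots n)"
  shows "infinite {n. 0 < n \<and>
           condition_number (unity_vandermonde n (\<zeta> n))
             > exp (real n powr (ln 2 / ln (ln (real n)))) / sqrt (real n)}
         \<and> (\<forall>r::real. 0 < r \<longrightarrow>
           (\<lambda>n. condition_number (unity_vandermonde n (\<zeta> n))) \<notin> O(\<lambda>n. real n powr r))"
proof -
  let ?cond = "\<lambda>n. condition_number (unity_vandermonde n (\<zeta> n))"
  let ?bound = "\<lambda>x::real. exp (x powr (ln 2 / ln (ln x))) / sqrt x"
  let ?S = "{n. 0 < n \<and> ?cond n > ?bound (real n)}"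
  have "eventually (\<lambda>k. primorial (k + 2) \<in> ?S) sequentially"
    using eventually_log_cyclotomic_primorial_large eventually_ge_at_top[of 2]
  proof eventually_elim
    case (elim k)
    define n where "n = primorial (k + 2)"
    define T where "T = exp (ln 2 * ln (real n) / ln (ln (real n)))"
    obtain u where u: "T < log_cyclotomic_primorial k u" using elim(1) unfolding T_def n_def by blast
    have n4: "4 \<le> n"
      unfolding n_def using strict_mono_imp_increasing[OF strict_mono_primorial, of "k + 2"] elim(2) by linarith
    have n_pos: "0 < n" using n4 by simp
    have powr_eq: "real n powr (ln 2 / ln (ln (real n))) = T"
      using n_pos by (simp add: powr_def T_def mult.commute)
    have "1 < ln (real n)"
    proof -
      have "ln (exp 1) < ln (4 :: real)" using exp_le by (subst ln_less_cancel_iff) auto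
      hence "1 < ln (4 :: real)" by simp
      also have "\<dots> \<le> ln (real n)" using n4 by (intro ln_mono) auto
      finally show ?thesis .
    qed
    hence "1 \<le> T" unfolding T_def by (simp add: ln_gt_zero less_imp_le)
    hence "2 \<le> exp T" using exp_ge_add_one_self[of T] by linarith
    \<comment> \<open>The denominator sqrt n is at least 2, and this factor alone pays for the -1 in
      the bound on the condition number.\<close>
    have "exp T / sqrt (real n) \<le> exp T / 2"
      using n4 real_sqrt_le_mono[of 4 "real n"] by (intro divide_left_mono) auto
    also have "\<dots> \<le> exp T - 1" using \<open>2 \<le> exp T\<close> by simp
    also have "\<dots> < exp (log_cyclotomic_primorial k u) - 1" using u by simp
    also have "\<dots> = cmod (cyclotomic n (of_real (exp (- exp u)))) - 1"
      unfolding n_def cyclotomic_primorial by simp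
    also have "\<dots> \<le> ?cond n"
      using n_pos assms by (intro cyclotomic_le_condition_number) auto
    finally show ?case using n_pos unfolding n_def[symmetric] by (simp add: powr_eq)
  qed
  then obtain N where N: "\<And>k. N \<le> k \<Longrightarrow> primorial (k + 2) \<in> ?S"
    unfolding eventually_sequentially by blast
  have "inj (\<lambda>k. primorial (k + 2))"
    using strict_mono_primorial by (intro strict_mono_imp_inj_on) (simp add: strict_mono_def)
  hence "infinite ((\<lambda>k. primorial (k + 2)) ` {N..})"
    using infinite_Ici by (simp add: finite_image_iff inj_on_subset)
  moreover have "(\<lambda>k. primorial (k + 2)) ` {N..} \<subseteq> ?S" using N by blast
  ultimately have inf: "infinite ?S" by (rule infinite_super[rotated])
  moreover have "?cond \<notin> O(\<lambda>n. real n powr r)" if r: "0 < r" for r :: real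
  proof
    assume "?cond \<in> O(\<lambda>n. real n powr r)"
    then obtain C where "eventually (\<lambda>n. norm (?cond n) \<le> C * norm (real n powr r)) sequentially"
      by (elim landau_o.bigE)
    \<comment> \<open>The inner power exp(ln 2 ln x / ln ln x) outgrows every multiple of ln x, so
      its exponential divided by sqrt x beats every power of x; a polynomial bound would then leave
      only finitely many n in \<open>?S\<close>.\<close>
    moreover have "eventually (\<lambda>x. C * x powr r < ?bound x) at_top" using r by real_asymp
    hence "eventually (\<lambda>n. C * real n powr r < ?bound (real n)) sequentially"
      by (rule eventually_compose_filterlim[OF _ filterlim_real_sequentially])
    ultimately have "eventually (\<lambda>n. n \<notin> ?S) sequentially"
      by eventually_elim auto
    hence "finite {n. \<not> n \<notin> ?S}"
      by (simp only: eventually_cofinite flip: cofinite_eq_sequentially)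
    hence "finite ?S" by simp
    thus False using inf by simp
  qed
  ultimately show ?thesis by blast
qed

end
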